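(* Let $r,\kappa$ be positive integers and let $k\ge 0$ be an integer satisfying $$\binom{k+\kappa-1}{\kappa-1}\ \ge\ r.$$ Then the parameters $(A,B)$ of a hidden Markov model with $r$ hidden states and $\kappa$ observable states are generically identifiable, up to label swapping, from the marginal distribution of $2k+1$ consecutive observed variables.
   Context: Hidden Markov model (HMM): $\{Z_n\}_{n\ge0}$ is a stationary Markov chain on $\{1,\dots,r\}$ with $r\times r$ transition matrix $A$ and initial distribution $\boldsymbol\pi$, assumed to be the stationary distribution of $A$; it is assumed that $A$ has a unique stationary distribution and that its entries are positive. Conditional on $\{Z_n\}_{n\ge0}$, the observations $\{X_n\}_{n\ge0}$ with values in $\{1,\dots,\kappa\}$ are independent, and the distribution of $X_n$ depends only on $Z_n$, through the $r\times\kappa$ stochastic matrix $B$ with entries $B(i,l)=\mathbb P(X_n=l\mid Z_n=i)$. The parameter space is the set of such pairs $(A,B)$, identified (by dropping one coordinate from each row) with a full-dimensional subset of $\mathbb R^{r(r+\kappa-2)}$. Label swapping: $(A,B)$ and $(A',B')$ are equal up to label swapping if there is an $r\times r$ permutation matrix $P$ with $A'=PAP^{T}$ and $B'=PB$. Generic identifiability up to label swapping from $2k+1$ consecutive variables: there is a proper algebraic subvariety $V$ of $\mathbb R^{r(r+\kappa-2)}$ (the common zero set of finitely many polynomials, not all identically zero) such that for every parameter $(A,B)$ outside $V$, every parameter $(A',B')$ in the parameter space giving the same joint distribution of $(X_0,X_1,\dots,X_{2k})$ equals $(A,B)$ up to label swapping. *)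

theory Defs
  imports
    "HOL-Probability.Product_PMF"
    "HOL-Library.Poly_Mapping"
    "HOL-Combinatorics.Permutations"
    "Jordan_Normal_Form.Matrix"
begin

text \<open>
  States are numbered from \<open>0\<close>: hidden states are \<open>{..<r}\<close>, observable states are
  \<open>{..<\<kappa>}\<close>. Matrices and vectors are those of \<^theory>\<open>Jordan_Normal_Form.Matrix\<close>, since the
  sizes \<open>r\<close> and \<open>\<kappa>\<close> are natural-number parameters.
\<close>

unbundle no vec_syntax

subsection \<open>Parameters of a hidden Markov model\<close>

definition stochastic_mat :: "real mat \<Rightarrow> bool" where
  "stochastic_mat M \<longleftrightarrow>
     (\<forall>i<dim_row M. (\<forall>j<dim_col M. 0 \<le> M $$ (i, j)) \<and> (\<Sum>j<dim_col M. M $$ (i, j)) = 1)"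

definition stationary_vec :: "real mat \<Rightarrow> real vec \<Rightarrow> bool" where
  "stationary_vec A p \<longleftrightarrow>
     p \<in> carrier_vec (dim_row A) \<and> (\<forall>i<dim_vec p. 0 \<le> p $ i) \<and> (\<Sum>i<dim_vec p. p $ i) = 1 \<and>
     A\<^sup>T *\<^sub>v p = p"

definition hmm_params :: "nat \<Rightarrow> nat \<Rightarrow> (real mat \<times> real mat) set" where
  "hmm_params r \<kappa> =
     {(A, B). A \<in> carrier_mat r r \<and> stochastic_mat A \<and>
              B \<in> carrier_mat r \<kappa> \<and> stochastic_mat B \<and>
              (\<exists>!p. stationary_vec A p) \<and>
              (\<forall>p. stationary_vec A p \<longrightarrow> (\<forall>i<r. 0 < p $ i))}"

text \<open>
  The coordinates of \<open>(A, B)\<close> in \<open>\<real>\<close> to the power \<open>r (r + \<kappa> - 2) = r (r - 1) + r (\<kappa> - 1)\<close>: the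
  rows of \<open>A\<close>, then the rows of \<open>B\<close>, each without its last entry. For \<open>r, \<kappa> \<ge> 1\<close>
  the truncated subtractions are exact.
\<close>

definition hmm_coords :: "nat \<Rightarrow> nat \<Rightarrow> real mat \<Rightarrow> real mat \<Rightarrow> real vec" where
  "hmm_coords r \<kappa> A B = vec (r * (r + \<kappa> - 2))
     (\<lambda>n. if n < r * (r - 1) then A $$ (n div (r - 1), n mod (r - 1))
          else B $$ ((n - r * (r - 1)) div (\<kappa> - 1), (n - r * (r - 1)) mod (\<kappa> - 1)))"


subsection \<open>The distribution of the observed variables\<close>

definition vec_pmf :: "real vec \<Rightarrow> nat pmf" where
  "vec_pmf v = embed_pmf (\<lambda>i. if i < dim_vec v then v $ i else 0)"

text \<open>The law of \<open>[Z\<^sub>0, \<dots>, Z\<^sub>m]\<close> for the Markov chain with initial vector \<open>p\<close> and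
  transition matrix \<open>A\<close>.\<close>

primrec markov_chain_pmf :: "real vec \<Rightarrow> real mat \<Rightarrow> nat \<Rightarrow> nat list pmf" where
  "markov_chain_pmf p A 0 = map_pmf (\<lambda>z. [z]) (vec_pmf p)"
| "markov_chain_pmf p A (Suc m) =
     bind_pmf (markov_chain_pmf p A m)
       (\<lambda>zs. map_pmf (\<lambda>z. zs @ [z]) (vec_pmf (row A (last zs))))"

text \<open>The joint law of \<open>(X\<^sub>0, \<dots>, X\<^sub>m)\<close>, a law on functions that vanish outside \<open>{..m}\<close>.
  Given the hidden path, the observations are independent and \<open>X\<^sub>i\<close> is distributed as the row
  of \<open>B\<close> belonging to \<open>Z\<^sub>i\<close>. The definite description is meaningful on \<open>hmm_params\<close>.\<close>

definition hmm_pmf :: "real mat \<Rightarrow> real mat \<Rightarrow> nat \<Rightarrow> (nat \<Rightarrow> nat) pmf" where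
  "hmm_pmf A B m =
     bind_pmf (markov_chain_pmf (THE p. stationary_vec A p) A m)
       (\<lambda>zs. Pi_pmf {..m} 0 (\<lambda>i. vec_pmf (row B (zs ! i))))"


subsection \<open>Label swapping\<close>

definition permutation_mat :: "nat \<Rightarrow> real mat \<Rightarrow> bool" where
  "permutation_mat r P \<longleftrightarrow>
     (\<exists>\<sigma>. \<sigma> permutes {..<r} \<and> P = mat r r (\<lambda>(i, j). if j = \<sigma> i then 1 else 0))"

definition label_swap_eq :: "nat \<Rightarrow> real mat \<times> real mat \<Rightarrow> real mat \<times> real mat \<Rightarrow> bool" where
  "label_swap_eq r = (\<lambda>(A, B) (A', B').
     \<exists>P. permutation_mat r P \<and> A' = P * A * P\<^sup>T \<and> B' = P * B)"


subsection \<open>Generic identifiability\<close>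

text \<open>
  A real polynomial in variables indexed by \<^typ>\<open>nat\<close> is a finitely supported map from
  monomials (finitely supported exponent maps) to coefficients.
\<close>

type_synonym real_mpoly = "(nat \<Rightarrow>\<^sub>0 nat) \<Rightarrow>\<^sub>0 real"

definition mpoly_in :: "nat \<Rightarrow> real_mpoly \<Rightarrow> bool" where
  "mpoly_in N f \<longleftrightarrow> (\<forall>m\<in>Poly_Mapping.keys f. Poly_Mapping.keys m \<subseteq> {..<N})"

definition mpoly_eval :: "real_mpoly \<Rightarrow> real vec \<Rightarrow> real" where
  "mpoly_eval f x =
     (\<Sum>m\<in>Poly_Mapping.keys f. Poly_Mapping.lookup f m *
        (\<Prod>i\<in>Poly_Mapping.keys m. (x $ i) ^ Poly_Mapping.lookup m i))"

definition proper_subvariety :: "nat \<Rightarrow> real vec set \<Rightarrow> bool" where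
  "proper_subvariety N V \<longleftrightarrow>
     (\<exists>F. finite F \<and> (\<forall>f\<in>F. mpoly_in N f) \<and> (\<exists>f\<in>F. f \<noteq> 0) \<and>
          V = {x \<in> carrier_vec N. \<forall>f\<in>F. mpoly_eval f x = 0})"

text \<open>Generic identifiability, up to label swapping, from \<open>(X\<^sub>0, \<dots>, X\<^sub>m)\<close>.\<close>

definition hmm_generically_identifiable :: "nat \<Rightarrow> nat \<Rightarrow> nat \<Rightarrow> bool" where
  "hmm_generically_identifiable r \<kappa> m \<longleftrightarrow>
     (\<exists>V. proper_subvariety (r * (r + \<kappa> - 2)) V \<and>
        (\<forall>(A, B)\<in>hmm_params r \<kappa>. hmm_coords r \<kappa> A B \<notin> V \<longrightarrow>
           (\<forall>(A', B')\<in>hmm_params r \<kappa>. hmm_pmf A' B' m = hmm_pmf A B m \<longrightarrow>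
              label_swap_eq r (A, B) (A', B'))))"

end

theory Submission
  imports Defs "Jordan_Normal_Form.Determinant"
begin

text \<open>
  Given the hidden state at the middle time \<open>k\<close>, the first \<open>k\<close> observations, the middle one and the
  last \<open>k\<close> observations are independent. The law of a word \<open>u l v\<close> is therefore
  \<open>\<Sum>i. \<alpha> u i * B i l * \<beta> v i\<close>, where \<open>\<alpha> u i\<close> is the joint probability of the past \<open>u\<close> and the
  middle state \<open>i\<close>, and \<open>\<beta> v i\<close> is the conditional probability of the future \<open>v\<close>. Suppose that \<open>\<alpha>\<close>
  and \<open>\<beta>\<close> have rank \<open>r\<close> as matrices and that the entries \<open>B i 0\<close> are distinct. Then,
  among all decompositions of the law with \<open>r\<close> states, this one is unique up to a permutation of the
  states, by a simultaneous diagonalisation (\<open>three_view_uniqueness\<close>). The transition matrix follows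
  by comparing future words of length \<open>k\<close> with those of length \<open>k - 1\<close> (\<open>hmm_uniqueness\<close>).

  It remains to see that the three conditions define the complement of a proper subvariety. A minor
  of \<open>\<beta>\<close> and the product of the differences of the \<open>B i 0\<close> are polynomials in the coordinates. A
  minor of \<open>\<alpha>\<close> involves the stationary distribution, which is replaced by a polynomial multiple of
  itself, a row of an adjugate matrix (\<open>stationary_cofactors_eq\<close>). The product \<open>genericity\<close> of the
  three polynomials does not vanish identically because it is nonzero at one point
  (\<open>exists_generic_point\<close>). For the identity as transition matrix, the entries of \<open>\<alpha>\<close> (with
  constant weights of the states) and of \<open>\<beta>\<close> are products of emission probabilities. They depend
  only on the multiset of the letters of the word, and for suitable emissions different multisets
  give different nodes of a Vandermonde matrix. There are \<open>(k + \<kappa> - 1) choose (\<kappa> - 1)\<close> multisets,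
  which is where the hypothesis on \<open>r\<close> enters. Nonvanishing persists under a small perturbation of
  the identity to a chain with uniform stationary distribution, for which the polynomial multiple
  of that distribution is not zero.
\<close>

section \<open>Determinants and the uniqueness of a three-view decomposition\<close>

text \<open>
  Likelihoods are handled as real functions of two indices; they become matrices only when a
  determinant is taken.
\<close>

definition square :: "nat \<Rightarrow> (nat \<Rightarrow> nat \<Rightarrow> real) \<Rightarrow> real mat" where
  "square r f = mat r r (\<lambda>(i, j). f i j)"

lemma square_carrier [simp]: "square r f \<in> carrier_mat r r"
  by (simp add: square_def)

lemma square_mult:
  "square r f * square r g = square r (\<lambda>i j. \<Sum>n<r. f i n * g n j)"
  by (rule eq_matI) (auto simp: square_def scalar_prod_def atLeast0LessThan)

lemma square_cong: "(\<And>i j. i < r \<Longrightarrow> j < r \<Longrightarrow> f i j = g i j) \<Longrightarrow> square r f = square r g"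
  by (rule eq_matI) (auto simp: square_def)

lemma det_square_transpose: "det (square r (\<lambda>i j. f j i)) = det (square r f)"
proof -
  have "square r (\<lambda>i j. f j i) = transpose_mat (square r f)"
    by (rule eq_matI) (auto simp: square_def)
  then show ?thesis by (simp add: det_transpose[of _ r])
qed

text \<open>
  The criterion by which all the nondegeneracy conditions below are used and verified: the
  columns are linearly independent.
\<close>

lemma det_square_nonzero_iff:
  "det (square r f) \<noteq> 0 \<longleftrightarrow>
     (\<forall>c. (\<forall>i<r. (\<Sum>j<r. f i j * c j) = 0) \<longrightarrow> (\<forall>j<r. c j = 0))"
proof
  assume d: "det (square r f) \<noteq> 0"
  show "\<forall>c. (\<forall>i<r. (\<Sum>j<r. f i j * c j) = 0) \<longrightarrow> (\<forall>j<r. c j = 0)"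
  proof (intro allI impI)
    fix c j assume c: "\<forall>i<r. (\<Sum>j<r. f i j * c j) = 0" and j: "j < r"
    have "square r f *\<^sub>v vec r c = 0\<^sub>v r"
      using c by (intro eq_vecI) (auto simp: square_def scalar_prod_def atLeast0LessThan)
    then have "vec r c = 0\<^sub>v r"
      using d det_0_iff_vec_prod_zero[OF square_carrier] by (metis vec_carrier)
    then have "vec r c $ j = 0\<^sub>v r $ j" by simp
    with j show "c j = 0" by simp
  qed
next
  assume ker: "\<forall>c. (\<forall>i<r. (\<Sum>j<r. f i j * c j) = 0) \<longrightarrow> (\<forall>j<r. c j = 0)"
  show "det (square r f) \<noteq> 0"
  proof
    assume "det (square r f) = 0"
    then obtain v where v: "v \<in> carrier_vec r" "v \<noteq> 0\<^sub>v r" "square r f *\<^sub>v v = 0\<^sub>v r"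
      using det_0_iff_vec_prod_zero[OF square_carrier] by blast
    have "(\<Sum>j<r. f i j * v $ j) = 0" if "i < r" for i
    proof -
      have "(square r f *\<^sub>v v) $ i = 0" using v(3) that by simp
      then show ?thesis using that v(1)
        by (simp add: square_def scalar_prod_def atLeast0LessThan)
    qed
    then have "\<forall>j<r. v $ j = 0" using ker by blast
    then have "v = 0\<^sub>v r" using v(1) by (intro eq_vecI) auto
    with v(2) show False by simp
  qed
qed

text \<open>Cramer's rule: the inverse is the adjugate divided by the determinant.\<close>

lemma left_inverse_of_det_nonzero:
  assumes "det (square r f) \<noteq> 0"
  obtains g where "\<And>i j. i < r \<Longrightarrow> j < r \<Longrightarrow> (\<Sum>n<r. g i n * f n j) = (if i = j then 1 else 0)"
proof
  let ?adj = "adj_mat (square r f)"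
  fix i j assume ij: "i < r" "j < r"
  have adj: "?adj \<in> carrier_mat r r" "?adj * square r f = det (square r f) \<cdot>\<^sub>m 1\<^sub>m r"
    using adj_mat[OF square_carrier[of r f]] by auto
  have "(\<Sum>n<r. ?adj $$ (i, n) * f n j) = (?adj * square r f) $$ (i, j)"
    using ij adj(1) by (simp add: square_def scalar_prod_def atLeast0LessThan)
  also have "\<dots> = (if i = j then det (square r f) else 0)"
    using ij by (simp add: adj(2))
  finally show "(\<Sum>n<r. (?adj $$ (i, n) / det (square r f)) * f n j) = (if i = j then 1 else 0)"
    using assms by (simp add: sum_divide_distrib[symmetric])
qed

text \<open>
  Three observations \<open>u\<close>, \<open>l\<close>, \<open>v\<close> that are independent given a hidden state \<open>i\<close> have a law
  \<open>\<Sum>i. \<alpha> u i * b i l * \<beta> v i\<close>, where the weight of \<open>i\<close> is absorbed into \<open>\<alpha>\<close>. Summing over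
  \<open>l\<close> turns the law into a matrix product of the \<open>\<alpha>\<close> and the \<open>\<beta>\<close>. Since it has full rank
  \<open>r\<close>, any second decomposition has full rank as well, and \<open>\<beta>' = S \<beta>\<close> for one square matrix
  \<open>S\<close>. Fixing \<open>l\<close> instead inserts the diagonal matrix of \<open>b\<close>, which gives
  \<open>S m i * b i l = b' m l * S m i\<close>: the rows of \<open>S\<close> are eigenvectors of a diagonal matrix, and for
  \<open>l = l\<^sub>0\<close> its eigenvalues are distinct. So every row of \<open>S\<close> has exactly one nonzero entry, and
  normalisation of \<open>\<beta>\<close> and \<open>\<beta>'\<close> makes that entry \<open>1\<close>.
\<close>

lemma three_view_uniqueness:
  fixes \<alpha> \<beta> \<alpha>' \<beta>' :: "'w \<Rightarrow> nat \<Rightarrow> real" and b b' :: "nat \<Rightarrow> 'l \<Rightarrow> real"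
  assumes eq: "\<And>u v l. u \<in> W \<Longrightarrow> v \<in> W \<Longrightarrow> l \<in> L \<Longrightarrow>
      (\<Sum>i<r. \<alpha> u i * b i l * \<beta> v i) = (\<Sum>i<r. \<alpha>' u i * b' i l * \<beta>' v i)"
    and b_sum: "\<And>i. i < r \<Longrightarrow> (\<Sum>l\<in>L. b i l) = 1"
    and b'_sum: "\<And>i. i < r \<Longrightarrow> (\<Sum>l\<in>L. b' i l) = 1"
    and \<beta>_sum: "\<And>i. i < r \<Longrightarrow> (\<Sum>v\<in>W. \<beta> v i) = 1"
    and \<beta>'_sum: "\<And>i. i < r \<Longrightarrow> (\<Sum>v\<in>W. \<beta>' v i) = 1"
    and w: "\<And>j. j < r \<Longrightarrow> w j \<in> W"
    and det_\<alpha>: "det (square r (\<lambda>j. \<alpha> (w j))) \<noteq> 0"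
    and det_\<beta>: "det (square r (\<lambda>j. \<beta> (w j))) \<noteq> 0"
    and l0: "l\<^sub>0 \<in> L" and inj: "inj_on (\<lambda>i. b i l\<^sub>0) {..<r}"
  obtains \<sigma> where "\<sigma> permutes {..<r}"
    and "\<And>i l. i < r \<Longrightarrow> l \<in> L \<Longrightarrow> b' i l = b (\<sigma> i) l"
    and "\<And>i v. i < r \<Longrightarrow> v \<in> W \<Longrightarrow> \<beta>' v i = \<beta> v (\<sigma> i)"
proof -
  have eq1: "(\<Sum>i<r. \<alpha> u i * \<beta> v i) = (\<Sum>i<r. \<alpha>' u i * \<beta>' v i)" if "u \<in> W" "v \<in> W" for u v
  proof -
    have "(\<Sum>l\<in>L. \<Sum>i<r. \<alpha> u i * b i l * \<beta> v i) = (\<Sum>i<r. \<alpha> u i * (\<Sum>l\<in>L. b i l) * \<beta> v i)"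
      by (subst sum.swap) (simp add: sum_distrib_left sum_distrib_right mult_ac)
    moreover have "(\<Sum>l\<in>L. \<Sum>i<r. \<alpha>' u i * b' i l * \<beta>' v i)
        = (\<Sum>i<r. \<alpha>' u i * (\<Sum>l\<in>L. b' i l) * \<beta>' v i)"
      by (subst sum.swap) (simp add: sum_distrib_left sum_distrib_right mult_ac)
    ultimately show ?thesis using eq[OF that] b_sum b'_sum by simp
  qed
  have "square r (\<lambda>j. \<alpha>' (w j)) * square r (\<lambda>i j. \<beta>' (w j) i)
      = square r (\<lambda>j. \<alpha> (w j)) * square r (\<lambda>i j. \<beta> (w j) i)"
    unfolding square_mult by (rule square_cong) (simp add: eq1 w)
  then have "det (square r (\<lambda>j. \<alpha>' (w j))) * det (square r (\<lambda>i j. \<beta>' (w j) i))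
      = det (square r (\<lambda>j. \<alpha> (w j))) * det (square r (\<lambda>i j. \<beta> (w j) i))"
    by (metis det_mult square_carrier)
  with det_\<alpha> det_\<beta> have det_\<alpha>': "det (square r (\<lambda>j. \<alpha>' (w j))) \<noteq> 0"
    and det_\<beta>': "det (square r (\<lambda>j. \<beta>' (w j))) \<noteq> 0"
    by (auto simp: det_square_transpose[of r "\<lambda>j. \<beta>' (w j)"] det_square_transpose[of r "\<lambda>j. \<beta> (w j)"])
  obtain g where g: "\<And>i j. i < r \<Longrightarrow> j < r \<Longrightarrow>
      (\<Sum>n<r. g i n * \<alpha>' (w n) j) = (if i = j then 1 else 0)"
    using left_inverse_of_det_nonzero[OF det_\<alpha>'] by blast
  \<comment> \<open>the matrix carrying the first decomposition to the second, a left inverse of \<open>\<alpha>'\<close> times \<open>\<alpha>\<close>\<close>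
  define S where "S m i = (\<Sum>n<r. g m n * \<alpha> (w n) i)" for m i
  have transfer: "(\<Sum>i<r. S m i * c i) = c' m"
    if "m < r" and c: "\<And>n. n < r \<Longrightarrow> (\<Sum>i<r. \<alpha> (w n) i * c i) = (\<Sum>i<r. \<alpha>' (w n) i * c' i)"
    for m c c'
  proof -
    have "(\<Sum>i<r. S m i * c i) = (\<Sum>n<r. g m n * (\<Sum>i<r. \<alpha> (w n) i * c i))"
      unfolding S_def sum_distrib_left sum_distrib_right by (subst sum.swap) (simp add: mult_ac)
    also have "\<dots> = (\<Sum>n<r. g m n * (\<Sum>i<r. \<alpha>' (w n) i * c' i))"
      using c by simp
    also have "\<dots> = (\<Sum>i<r. (\<Sum>n<r. g m n * \<alpha>' (w n) i) * c' i)"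
      unfolding sum_distrib_left sum_distrib_right by (subst sum.swap) (simp add: mult_ac)
    also have "\<dots> = (\<Sum>i<r. (if m = i then 1 else 0) * c' i)"
      using g \<open>m < r\<close> by simp
    also have "\<dots> = c' m" using \<open>m < r\<close> by (simp add: if_distrib[of "\<lambda>x. x * _"] cong: if_cong)
    finally show ?thesis .
  qed
  have S_\<beta>: "(\<Sum>i<r. S m i * \<beta> v i) = \<beta>' v m" if "m < r" "v \<in> W" for m v
    using eq1 w that by (intro transfer) auto
  have S_b\<beta>: "(\<Sum>i<r. S m i * (b i l * \<beta> v i)) = b' m l * \<beta>' v m"
    if "m < r" "v \<in> W" "l \<in> L" for m v l
    using eq w that by (intro transfer) (auto simp: mult.assoc)
  have S_b: "S m i * (b i l - b' m l) = 0" if "m < r" "l \<in> L" "i < r" for m i l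
  proof -
    have "(\<Sum>i<r. \<beta> (w j) i * (S m i * (b i l - b' m l))) = 0" if "j < r" for j
    proof -
      have "(\<Sum>i<r. \<beta> (w j) i * (S m i * (b i l - b' m l)))
          = (\<Sum>i<r. S m i * (b i l * \<beta> (w j) i)) - b' m l * (\<Sum>i<r. S m i * \<beta> (w j) i)"
        by (simp add: sum_subtractf sum_distrib_left algebra_simps)
      then show ?thesis using S_\<beta> S_b\<beta> w \<open>m < r\<close> \<open>l \<in> L\<close> \<open>j < r\<close> by simp
    qed
    then have "\<forall>i<r. S m i * (b i l - b' m l) = 0"
      using det_\<beta>[unfolded det_square_nonzero_iff, rule_format,
          where c = "\<lambda>i. S m i * (b i l - b' m l)"] by blast
    with \<open>i < r\<close> show ?thesis by blast
  qed
  have S_sum: "(\<Sum>i<r. S m i) = 1" if "m < r" for m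
  proof -
    have "(\<Sum>i<r. S m i) = (\<Sum>i<r. S m i * (\<Sum>v\<in>W. \<beta> v i))" using \<beta>_sum by simp
    also have "\<dots> = (\<Sum>v\<in>W. \<Sum>i<r. S m i * \<beta> v i)"
      unfolding sum_distrib_left by (rule sum.swap)
    also have "\<dots> = 1" using S_\<beta> \<beta>'_sum that by simp
    finally show ?thesis .
  qed
  have "\<exists>i<r. S m i \<noteq> 0" if "m < r" for m
  proof (rule ccontr)
    assume "\<not> ?thesis"
    then have "(\<Sum>i<r. S m i) = 0" by simp
    with S_sum[OF that] show False by simp
  qed
  then obtain \<tau> where \<tau>: "\<And>m. m < r \<Longrightarrow> \<tau> m < r \<and> S m (\<tau> m) \<noteq> 0" by metis
  have b'_eq: "b' m l = b (\<tau> m) l" if "m < r" "l \<in> L" for m l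
    using S_b[OF that, of "\<tau> m"] \<tau>[OF that(1)] by simp
  have S_zero: "S m i = 0" if "m < r" "i < r" "i \<noteq> \<tau> m" for m i
  proof -
    have "b i l\<^sub>0 \<noteq> b (\<tau> m) l\<^sub>0"
      using inj_onD[OF inj, of i "\<tau> m"] that \<tau> by auto
    then show ?thesis using S_b[OF that(1) l0 that(2)] b'_eq[OF that(1) l0] by simp
  qed
  have \<beta>'_eq: "\<beta>' v m = \<beta> v (\<tau> m)" if "m < r" "v \<in> W" for m v
  proof -
    have collapse: "(\<Sum>i<r. S m i * c i) = S m (\<tau> m) * c (\<tau> m)" for c
    proof -
      have "(\<Sum>i<r. S m i * c i) = (\<Sum>i\<in>{\<tau> m}. S m i * c i)"
        using \<tau> S_zero \<open>m < r\<close> by (intro sum.mono_neutral_right) auto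
      then show ?thesis by simp
    qed
    have "S m (\<tau> m) = 1" using collapse[of "\<lambda>_. 1"] S_sum[OF \<open>m < r\<close>] by simp
    then show ?thesis using collapse[of "\<beta> v"] S_\<beta>[OF that] by simp
  qed
  have inj_\<tau>: "inj_on \<tau> {..<r}"
  proof (rule inj_onI, rule ccontr)
    fix m n assume mn: "m \<in> {..<r}" "n \<in> {..<r}" "\<tau> m = \<tau> n" "m \<noteq> n"
    \<comment> \<open>two equal columns of \<open>\<beta>'\<close> would put the difference of two unit vectors into its kernel\<close>
    define c where "c i = (if i = m then 1 else if i = n then -1 else 0 :: real)" for i
    have "(\<Sum>i<r. \<beta>' (w j) i * c i) = 0" if "j < r" for j
    proof -
      have "(\<Sum>i<r. \<beta>' (w j) i * c i) = (\<Sum>i\<in>{m, n}. \<beta>' (w j) i * c i)"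
        using mn by (intro sum.mono_neutral_right) (auto simp: c_def)
      also have "\<dots> = 0" using mn \<beta>'_eq w that by (auto simp: c_def)
      finally show ?thesis .
    qed
    then have "\<forall>i<r. c i = 0"
      using det_\<beta>'[unfolded det_square_nonzero_iff, rule_format, where c = c] by blast
    then have "c m = 0" using mn(1) by simp
    then show False by (simp add: c_def)
  qed
  define \<sigma> where "\<sigma> i = (if i < r then \<tau> i else i)" for i
  have "\<sigma> permutes {..<r}"
  proof (rule bij_imp_permutes)
    have "inj_on \<sigma> {..<r}" using inj_\<tau> by (simp add: inj_on_def \<sigma>_def)
    moreover have "\<sigma> ` {..<r} \<subseteq> {..<r}" using \<tau> by (auto simp: \<sigma>_def)
    ultimately show "bij_betw \<sigma> {..<r} {..<r}"
      by (simp add: bij_betw_def endo_inj_surj)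
  qed (simp add: \<sigma>_def)
  then show thesis using b'_eq \<beta>'_eq by (intro that[of \<sigma>]) (auto simp: \<sigma>_def)
qed

section \<open>Likelihoods of words\<close>

definition words :: "nat \<Rightarrow> nat \<Rightarrow> nat list set" where
  "words \<kappa> k = {v. set v \<subseteq> {..<\<kappa>} \<and> length v = k}"

lemma finite_words: "finite (words r m)"
  unfolding words_def by (rule finite_lists_length_eq) simp

lemma last_words: "zs \<in> words r (Suc m) \<Longrightarrow> last zs < r"
  by (cases zs rule: rev_cases) (auto simp: words_def)

lemma sum_words_Suc:
  fixes f :: "nat list \<Rightarrow> real"
  shows "(\<Sum>v\<in>words \<kappa> (Suc k). f v) = (\<Sum>x<\<kappa>. \<Sum>v\<in>words \<kappa> k. f (x # v))"
proof -
  have "words \<kappa> (Suc k) = (\<lambda>(x, v). x # v) ` ({..<\<kappa>} \<times> words \<kappa> k)"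
    by (auto simp: words_def image_iff length_Suc_conv)
  then have "(\<Sum>v\<in>words \<kappa> (Suc k). f v) = (\<Sum>(x, v)\<in>{..<\<kappa>} \<times> words \<kappa> k. f (x # v))"
    by (simp add: sum.reindex inj_on_def case_prod_unfold)
  then show ?thesis by (simp add: sum.cartesian_product)
qed

text \<open>
  The unnormalised filter: started from \<open>p\<close>, the value at \<open>j\<close> is the joint weight of emitting the
  given word and being in state \<open>j\<close> one step after its last letter. With this timing the words
  before and after a given letter enter symmetrically, and concatenation of words is iteration.
\<close>

primrec forward ::
  "nat \<Rightarrow> (nat \<Rightarrow> nat \<Rightarrow> real) \<Rightarrow> (nat \<Rightarrow> nat \<Rightarrow> real) \<Rightarrow> (nat \<Rightarrow> real) \<Rightarrow> nat list \<Rightarrow> nat \<Rightarrow> real"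
where
  "forward r a b p [] = p"
| "forward r a b p (x # xs) = forward r a b (\<lambda>j. \<Sum>i<r. p i * b i x * a i j) xs"

text \<open>
  The probability of emitting the given word after leaving state \<open>i\<close>; the letter emitted by \<open>i\<close>
  itself is not part of the word.
\<close>

primrec backward ::
  "nat \<Rightarrow> (nat \<Rightarrow> nat \<Rightarrow> real) \<Rightarrow> (nat \<Rightarrow> nat \<Rightarrow> real) \<Rightarrow> nat list \<Rightarrow> nat \<Rightarrow> real"
where
  "backward r a b [] i = 1"
| "backward r a b (x # xs) i = (\<Sum>j<r. a i j * (b j x * backward r a b xs j))"

lemma forward_append:
  "forward r a b p (u @ v) = forward r a b (forward r a b p u) v"
  by (induction u arbitrary: p) simp_all

lemma forward_snoc:
  "forward r a b p (u @ [x]) j = (\<Sum>i<r. forward r a b p u i * b i x * a i j)"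
  by (simp add: forward_append)

lemma forward_smult:
  "forward r a b (\<lambda>i. c * p i) u j = c * forward r a b p u j"
  by (induction u arbitrary: p)
    (simp_all add: mult.assoc sum_distrib_left[symmetric])

lemma forward_cong:
  assumes "\<And>i. i < r \<Longrightarrow> p i = p' i" and "\<And>i j. i < r \<Longrightarrow> j < r \<Longrightarrow> a i j = a' i j"
    and "\<And>i x. i < r \<Longrightarrow> x \<in> set u \<Longrightarrow> b i x = b' i x" and "j < r"
  shows "forward r a b p u j = forward r a' b' p' u j"
  using assms
proof (induction u arbitrary: p p')
  case (Cons x u)
  show ?case
    unfolding forward.simps by (rule Cons.IH) (use Cons.prems in auto)
qed simp

lemma backward_cong:
  assumes "\<And>i j. i < r \<Longrightarrow> j < r \<Longrightarrow> a i j = a' i j"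
    and "\<And>i x. i < r \<Longrightarrow> x \<in> set u \<Longrightarrow> b i x = b' i x" and "i < r"
  shows "backward r a b u i = backward r a' b' u i"
  using assms by (induction u arbitrary: i) auto

text \<open>
  The letter \<open>x\<close> splits the word: given the state that emits it, past (here condensed into \<open>p\<close>),
  present and future are independent. This is how the three views arise.
\<close>

lemma sum_forward:
  assumes "\<And>i. i < r \<Longrightarrow> (\<Sum>j<r. a i j) = 1"
  shows "(\<Sum>j<r. forward r a b p (x # v) j) = (\<Sum>i<r. p i * b i x * backward r a b v i)"
proof (induction v arbitrary: p x)
  case Nil
  have "(\<Sum>j<r. forward r a b p [x] j) = (\<Sum>i<r. p i * b i x * (\<Sum>j<r. a i j))"
    unfolding forward.simps sum_distrib_left by (rule sum.swap)
  then show ?case using assms by simp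
next
  case (Cons y v)
  have "(\<Sum>j<r. forward r a b p (x # y # v) j)
      = (\<Sum>j<r. (\<Sum>i<r. p i * b i x * a i j) * b j y * backward r a b v j)"
    unfolding forward.simps(2)[of _ _ _ p] by (rule Cons.IH)
  also have "\<dots> = (\<Sum>i<r. p i * b i x * backward r a b (y # v) i)"
    unfolding backward.simps sum_distrib_left sum_distrib_right
    by (subst sum.swap) (simp add: mult_ac)
  finally show ?case .
qed

lemma sum_backward_words:
  assumes a: "\<And>i. i < r \<Longrightarrow> (\<Sum>j<r. a i j) = 1" and b: "\<And>i. i < r \<Longrightarrow> (\<Sum>l<\<kappa>. b i l) = 1"
    and "i < r"
  shows "(\<Sum>v\<in>words \<kappa> k. backward r a b v i) = 1"
  using \<open>i < r\<close>
proof (induction k arbitrary: i)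
  case 0
  then show ?case by (simp add: words_def cong: conj_cong)
next
  case (Suc k)
  have "(\<Sum>v\<in>words \<kappa> (Suc k). backward r a b v i)
      = (\<Sum>x<\<kappa>. \<Sum>j<r. a i j * b j x * (\<Sum>v\<in>words \<kappa> k. backward r a b v j))"
    unfolding sum_words_Suc backward.simps sum_distrib_left
    by (subst sum.swap) (simp add: mult_ac)
  also have "\<dots> = (\<Sum>x<\<kappa>. \<Sum>j<r. a i j * b j x)" using Suc.IH by simp
  also have "\<dots> = (\<Sum>j<r. a i j * (\<Sum>x<\<kappa>. b j x))"
    unfolding sum_distrib_left by (rule sum.swap)
  finally show ?case using a b Suc.prems by simp
qed

text \<open>
  Marginalising the last letter passes from future words of length \<open>k\<close> to those of length
  \<open>k - 1\<close>, from which the transition matrix is read off below.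
\<close>

lemma sum_backward_snoc:
  assumes a: "\<And>i. i < r \<Longrightarrow> (\<Sum>j<r. a i j) = 1" and b: "\<And>i. i < r \<Longrightarrow> (\<Sum>l<\<kappa>. b i l) = 1"
    and "i < r"
  shows "(\<Sum>x<\<kappa>. backward r a b (v @ [x]) i) = backward r a b v i"
  using \<open>i < r\<close>
proof (induction v arbitrary: i)
  case Nil
  have "(\<Sum>x<\<kappa>. backward r a b ([] @ [x]) i) = (\<Sum>j<r. a i j * (\<Sum>x<\<kappa>. b j x))"
    by (simp add: sum_distrib_left) (rule sum.swap)
  then show ?case using a b Nil by simp
next
  case (Cons y v)
  have "(\<Sum>x<\<kappa>. backward r a b ((y # v) @ [x]) i)
      = (\<Sum>j<r. a i j * (b j y * (\<Sum>x<\<kappa>. backward r a b (v @ [x]) j)))"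
    by (simp add: sum_distrib_left) (rule sum.swap)
  then show ?case using Cons.IH by simp
qed

text \<open>
  The three views are the first \<open>k\<close> letters, the middle letter and the last \<open>k\<close> letters, so
  \<open>three_view_uniqueness\<close> yields the permutation \<open>\<sigma>\<close> and the emission probabilities. For the
  transitions let \<open>\<gamma> v j\<close> be the probability that state \<open>j\<close> emits the first letter of \<open>v\<close>, and the
  subsequent states the rest. Then \<open>backward\<close> is the product of the transition matrix and \<open>\<gamma>\<close>;
  \<open>\<gamma>\<close> is known up to \<open>\<sigma>\<close> from the emissions and from the marginals of \<open>backward\<close>, and it is
  nonsingular as a factor of a nonsingular matrix, so it can be cancelled. Words of length \<open>0\<close> carry
  no information on transitions, but there is only one state in that case.
\<close>

lemma hmm_uniqueness:
  fixes a b a' b' :: "nat \<Rightarrow> nat \<Rightarrow> real" and p p' :: "nat \<Rightarrow> real"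
  assumes a: "\<And>i. i < r \<Longrightarrow> (\<Sum>j<r. a i j) = 1" and b: "\<And>i. i < r \<Longrightarrow> (\<Sum>l<\<kappa>. b i l) = 1"
    and a': "\<And>i. i < r \<Longrightarrow> (\<Sum>j<r. a' i j) = 1" and b': "\<And>i. i < r \<Longrightarrow> (\<Sum>l<\<kappa>. b' i l) = 1"
    and eq: "\<And>v. v \<in> words \<kappa> (2 * k + 1) \<Longrightarrow>
       (\<Sum>j<r. forward r a b p v j) = (\<Sum>j<r. forward r a' b' p' v j)"
    and w: "\<And>j. j < r \<Longrightarrow> w j \<in> words \<kappa> k"
    and det_f: "det (square r (\<lambda>j. forward r a b p (w j))) \<noteq> 0"
    and det_b: "det (square r (\<lambda>j. backward r a b (w j))) \<noteq> 0"
    and "0 < \<kappa>" and inj: "inj_on (\<lambda>i. b i 0) {..<r}"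
    and k: "k = 0 \<Longrightarrow> r = 1"
  obtains \<sigma> where "\<sigma> permutes {..<r}"
    and "\<And>i j. i < r \<Longrightarrow> j < r \<Longrightarrow> a' i j = a (\<sigma> i) (\<sigma> j)"
    and "\<And>i l. i < r \<Longrightarrow> l < \<kappa> \<Longrightarrow> b' i l = b (\<sigma> i) l"
proof -
  have split: "(\<Sum>i<r. forward r a b p u i * b i l * backward r a b v i) =
      (\<Sum>i<r. forward r a' b' p' u i * b' i l * backward r a' b' v i)"
    if "u \<in> words \<kappa> k" "v \<in> words \<kappa> k" "l \<in> {..<\<kappa>}" for u v l
  proof -
    have "u @ l # v \<in> words \<kappa> (2 * k + 1)" using that by (auto simp: words_def)
    from eq[OF this] show ?thesis
      using sum_forward[of r a, OF a] sum_forward[of r a', OF a'] by (simp only: forward_append)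
  qed
  obtain \<sigma> where \<sigma>: "\<sigma> permutes {..<r}"
    and \<sigma>_b: "\<And>i l. i < r \<Longrightarrow> l \<in> {..<\<kappa>} \<Longrightarrow> b' i l = b (\<sigma> i) l"
    and \<sigma>_back: "\<And>i v. i < r \<Longrightarrow> v \<in> words \<kappa> k \<Longrightarrow> backward r a' b' v i = backward r a b v (\<sigma> i)"
    using three_view_uniqueness[where L = "{..<\<kappa>}" and W = "words \<kappa> k" and b = b and b' = b',
        OF split b b' sum_backward_words[of r a, OF a b] sum_backward_words[of r a', OF a' b']
          w det_f det_b _ inj] \<open>0 < \<kappa>\<close> by auto
  have \<sigma>_lt: "\<sigma> i < r" if "i < r" for i
    using permutes_in_image[OF \<sigma>, of i] that by simp
  have "a' i j = a (\<sigma> i) (\<sigma> j)" if "i < r" "j < r" for i j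
  proof (cases k)
    case 0
    then have "r = 1" by (rule k)
    then show ?thesis using a[of 0] a'[of 0] that \<sigma>_lt[of 0] by simp
  next
    case (Suc k')
    define \<gamma> where "\<gamma> v j = b j (hd v) * backward r a b (tl v) j" for v j
    have back_eq: "backward r a b v i = (\<Sum>j<r. a i j * \<gamma> v j)" if "v \<in> words \<kappa> k" for v i
      using that Suc by (cases v) (auto simp: words_def \<gamma>_def)
    have \<gamma>': "b' j (hd v) * backward r a' b' (tl v) j = \<gamma> v (\<sigma> j)"
      if vj: "v \<in> words \<kappa> k" "j < r" for v j
    proof -
      obtain x u where v: "v = x # u" "x < \<kappa>" "u \<in> words \<kappa> k'"
        using vj Suc by (cases v) (auto simp: words_def)
      have "backward r a' b' u j = (\<Sum>x<\<kappa>. backward r a' b' (u @ [x]) j)"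
        using sum_backward_snoc[of r a', OF a' b'] vj by simp
      also have "\<dots> = (\<Sum>x<\<kappa>. backward r a b (u @ [x]) (\<sigma> j))"
        using v(3) Suc vj by (intro sum.cong refl \<sigma>_back) (auto simp: words_def)
      also have "\<dots> = backward r a b u (\<sigma> j)"
        using sum_backward_snoc[of r a, OF a b] \<sigma>_lt vj by simp
      finally show ?thesis using v \<sigma>_b vj by (simp add: \<gamma>_def)
    qed
    have det_\<gamma>: "det (square r (\<lambda>m. \<gamma> (w m))) \<noteq> 0"
    proof -
      have "square r (\<lambda>m. backward r a b (w m)) = square r (\<lambda>m. \<gamma> (w m)) * square r (\<lambda>j i. a i j)"
        unfolding square_mult by (rule square_cong) (simp add: back_eq w mult.commute)
      then show ?thesis using det_b det_mult[OF square_carrier square_carrier] by (metis mult_zero_left)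
    qed
    \<comment> \<open>the row of differences, written so that reindexing by \<open>\<sigma>\<close> exhibits it in the kernel of \<open>\<gamma>\<close>\<close>
    define c where "c n = a' i (inv_into UNIV \<sigma> n) - a (\<sigma> i) n" for n
    have "(\<Sum>n<r. \<gamma> (w m) n * c n) = 0" if "m < r" for m
    proof -
      note wm = w[OF that]
      have "(\<Sum>n<r. \<gamma> (w m) n * c n) = (\<Sum>n<r. \<gamma> (w m) (\<sigma> n) * c (\<sigma> n))"
        using sum.permute[OF \<sigma>, of "\<lambda>n. \<gamma> (w m) n * c n"] by (simp add: o_def)
      also have "\<dots> = (\<Sum>n<r. a' i n * \<gamma> (w m) (\<sigma> n)) - (\<Sum>n<r. a (\<sigma> i) (\<sigma> n) * \<gamma> (w m) (\<sigma> n))"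
        by (simp add: c_def permutes_inverses[OF \<sigma>] sum_subtractf algebra_simps)
      also have "(\<Sum>n<r. a (\<sigma> i) (\<sigma> n) * \<gamma> (w m) (\<sigma> n)) = backward r a b (w m) (\<sigma> i)"
        using sum.permute[OF \<sigma>, of "\<lambda>n. a (\<sigma> i) n * \<gamma> (w m) n"] back_eq[OF wm] by (simp add: o_def)
      also have "(\<Sum>n<r. a' i n * \<gamma> (w m) (\<sigma> n)) = backward r a' b' (w m) i"
        using wm \<gamma>'[OF wm] Suc by (cases "w m") (auto simp: words_def)
      finally show ?thesis using \<sigma>_back[OF \<open>i < r\<close> wm] by simp
    qed
    then have "\<forall>n<r. c n = 0"
      using det_\<gamma>[unfolded det_square_nonzero_iff, rule_format, where c = c] by blast
    then have "c (\<sigma> j) = 0" using \<sigma>_lt that by blast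
    then show ?thesis by (simp add: c_def permutes_inverses[OF \<sigma>])
  qed
  then show thesis using \<sigma> \<sigma>_b that by blast
qed

section \<open>The law of the observed variables\<close>

definition prob_vec :: "real vec \<Rightarrow> bool" where
  "prob_vec v \<longleftrightarrow> (\<forall>i<dim_vec v. 0 \<le> v $ i) \<and> (\<Sum>i<dim_vec v. v $ i) = 1"

lemma pmf_vec_pmf:
  assumes "prob_vec v"
  shows "pmf (vec_pmf v) i = (if i < dim_vec v then v $ i else 0)"
  unfolding vec_pmf_def
proof (rule pmf_embed_pmf)
  show "0 \<le> (if i < dim_vec v then v $ i else 0)" for i
    using assms by (simp add: prob_vec_def)
  have "(\<integral>\<^sup>+ i. ennreal (if i < dim_vec v then v $ i else 0) \<partial>count_space UNIV)
      = (\<Sum>i<dim_vec v. ennreal (if i < dim_vec v then v $ i else 0))"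
    by (rule nn_integral_count_space') (auto split: if_splits)
  also have "\<dots> = ennreal (\<Sum>i<dim_vec v. v $ i)"
    using assms by (subst sum_ennreal[symmetric]) (auto simp: prob_vec_def)
  finally show "(\<integral>\<^sup>+ i. ennreal (if i < dim_vec v then v $ i else 0) \<partial>count_space UNIV) = 1"
    using assms by (simp add: prob_vec_def)
qed

lemma set_vec_pmf: "prob_vec v \<Longrightarrow> set_pmf (vec_pmf v) \<subseteq> {..<dim_vec v}"
  by (auto simp: set_pmf_iff pmf_vec_pmf split: if_splits)

lemma expectation_vec_pmf:
  fixes g :: "nat \<Rightarrow> real"
  assumes "prob_vec v"
  shows "measure_pmf.expectation (vec_pmf v) g = (\<Sum>i<dim_vec v. v $ i * g i)"
  using assms set_vec_pmf[OF assms]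
  by (subst integral_measure_pmf_real[of "{..<dim_vec v}"]) (auto simp: pmf_vec_pmf mult.commute)

lemma prob_vec_row:
  assumes "stochastic_mat A" "A \<in> carrier_mat n m" "i < n"
  shows "prob_vec (row A i)"
  using assms by (auto simp: stochastic_mat_def prob_vec_def)

lemma set_markov_chain_pmf:
  assumes "stochastic_mat A" "A \<in> carrier_mat r r" "prob_vec p" "dim_vec p = r"
  shows "set_pmf (markov_chain_pmf p A m) \<subseteq> words r (Suc m)"
proof (induction m)
  case 0
  then show ?case using set_vec_pmf[OF assms(3)] assms(4) by (auto simp: words_def)
next
  case (Suc m)
  show ?case
  proof
    fix zs assume "zs \<in> set_pmf (markov_chain_pmf p A (Suc m))"
    then obtain ys z where ys: "ys \<in> set_pmf (markov_chain_pmf p A m)"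
      and z: "z \<in> set_pmf (vec_pmf (row A (last ys)))" and zs: "zs = ys @ [z]"
      by auto
    have "ys \<in> words r (Suc m)" using Suc ys by blast
    moreover from this have "last ys < r" by (cases ys rule: rev_cases) (auto simp: words_def)
    moreover from this have "z < r"
      using z set_vec_pmf[OF prob_vec_row[OF assms(1,2)], of "last ys"] assms(2) by auto
    ultimately show "zs \<in> words r (Suc (Suc m))" using zs by (auto simp: words_def)
  qed
qed

text \<open>
  The filter recursion for the expected likelihood of the observations. The factor \<open>h\<close> of the final
  state is needed for the induction: extending the chain by one step replaces \<open>h\<close> by its average
  over the next state.
\<close>

lemma expectation_markov_chain_pmf:
  fixes h :: "nat \<Rightarrow> real"
  assumes "stochastic_mat A" "A \<in> carrier_mat r r" "prob_vec p" "dim_vec p = r"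
  defines "a \<equiv> \<lambda>i j. A $$ (i, j)"
  shows "measure_pmf.expectation (markov_chain_pmf p A m)
      (\<lambda>zs. (\<Prod>i\<le>m. b (zs ! i) (f i)) * h (last zs))
    = (\<Sum>z<r. forward r a b (($) p) (map f [0..<m]) z * b z (f m) * h z)"
proof (induction m arbitrary: h)
  case 0
  then show ?case using assms by (simp add: expectation_vec_pmf mult.assoc)
next
  case (Suc m)
  let ?G = "\<lambda>zs. (\<Prod>i\<le>Suc m. b (zs ! i) (f i)) * h (last zs)"
  let ?H = "\<lambda>y. \<Sum>z<r. a y z * (b z (f (Suc m)) * h z)"
  have set_chain: "set_pmf (markov_chain_pmf p A m) \<subseteq> words r (Suc m)"
    using assms by (intro set_markov_chain_pmf)
  have step: "measure_pmf.expectation (map_pmf (\<lambda>z. zs @ [z]) (vec_pmf (row A (last zs)))) ?G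
      = (\<Prod>i\<le>m. b (zs ! i) (f i)) * ?H (last zs)" if "zs \<in> words r (Suc m)" for zs
  proof -
    have len: "length zs = Suc m" using that by (simp add: words_def)
    have "measure_pmf.expectation (map_pmf (\<lambda>z. zs @ [z]) (vec_pmf (row A (last zs)))) ?G
      = (\<Sum>z<r. A $$ (last zs, z) * ?G (zs @ [z]))"
      using assms last_words[OF that] prob_vec_row[OF assms(1,2)]
      by (simp add: expectation_vec_pmf)
    also have "\<dots> = (\<Sum>z<r. (\<Prod>i\<le>m. b (zs ! i) (f i)) * (a (last zs) z * (b z (f (Suc m)) * h z)))"
      using len by (intro sum.cong refl) (simp add: nth_append a_def)
    finally show ?thesis by (simp add: sum_distrib_left)
  qed
  have "measure_pmf.expectation (markov_chain_pmf p A (Suc m)) ?G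
      = (\<Sum>zs\<in>words r (Suc m). pmf (markov_chain_pmf p A m) zs *
          ((\<Prod>i\<le>m. b (zs ! i) (f i)) * ?H (last zs)))"
    unfolding markov_chain_pmf.simps
  proof (subst pmf_expectation_bind[OF finite_words _ set_chain])
    fix zs assume "zs \<in> words r (Suc m)"
    then have "prob_vec (row A (last zs))" using last_words prob_vec_row assms by blast
    then show "finite (set_pmf (map_pmf (\<lambda>z. zs @ [z]) (vec_pmf (row A (last zs)))))"
      using finite_subset[OF set_vec_pmf] by simp
  qed (intro sum.cong refl, simp only: real_scaleR_def step)
  also have "\<dots> = measure_pmf.expectation (markov_chain_pmf p A m)
      (\<lambda>zs. (\<Prod>i\<le>m. b (zs ! i) (f i)) * ?H (last zs))"
    using set_chain by (subst integral_measure_pmf_real[OF finite_words[of r "Suc m"]]) (auto simp: mult.commute)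
  also have "\<dots> = (\<Sum>y<r. forward r a b (($) p) (map f [0..<m]) y * b y (f m) * ?H y)"
    by (rule Suc.IH)
  also have "\<dots> = (\<Sum>z<r. forward r a b (($) p) (map f [0..<m] @ [f m]) z * (b z (f (Suc m)) * h z))"
    unfolding forward_snoc sum_distrib_left sum_distrib_right by (subst sum.swap) (simp add: mult_ac)
  finally show ?case by (simp add: mult.assoc)
qed

text \<open>
  Since \<open>forward\<close> runs one step past the last observation, the sum over all states marginalises the
  hidden state that follows it.
\<close>

lemma pmf_hmm_pmf:
  assumes A: "stochastic_mat A" "A \<in> carrier_mat r r"
    and B: "stochastic_mat B" "B \<in> carrier_mat r \<kappa>"
    and p: "prob_vec p" "dim_vec p = r" "(THE p. stationary_vec A p) = p"
    and f: "\<And>i. i > m \<Longrightarrow> f i = 0" "\<And>i. i \<le> m \<Longrightarrow> f i < \<kappa>"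
  defines "a \<equiv> \<lambda>i j. A $$ (i, j)" and "b \<equiv> \<lambda>i l. B $$ (i, l)"
  shows "pmf (hmm_pmf A B m) f = (\<Sum>z<r. forward r a b (($) p) (map f [0..<Suc m]) z)"
proof -
  have emit: "pmf (Pi_pmf {..m} 0 (\<lambda>i. vec_pmf (row B (zs ! i)))) f = (\<Prod>i\<le>m. b (zs ! i) (f i))"
    if "zs \<in> words r (Suc m)" for zs
  proof -
    have "zs ! i < r" if "i \<le> m" for i
      using \<open>zs \<in> _\<close> that nth_mem[of i zs] by (force simp: words_def)
    then show ?thesis
      using B f by (subst pmf_Pi')
        (auto intro!: prod.cong simp: pmf_vec_pmf[OF prob_vec_row[OF B]] b_def)
  qed
  have "pmf (hmm_pmf A B m) f = measure_pmf.expectation (markov_chain_pmf p A m)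
      (\<lambda>zs. (\<Prod>i\<le>m. b (zs ! i) (f i)) * 1)"
    unfolding hmm_pmf_def pmf_bind p(3)
    using set_markov_chain_pmf[OF A p(1,2), of m]
    by (intro integral_cong_AE) (auto simp: AE_measure_pmf_iff emit)
  also have "\<dots> = (\<Sum>z<r. forward r a b (($) p) (map f [0..<m]) z * b z (f m) * 1)"
    unfolding a_def using A p(1,2) by (rule expectation_markov_chain_pmf)
  also have "\<dots> = (\<Sum>i<r. forward r a b (($) p) (map f [0..<m]) i * b i (f m) * (\<Sum>z<r. a i z))"
    using A by (simp add: stochastic_mat_def a_def)
  also have "\<dots> = (\<Sum>z<r. forward r a b (($) p) (map f [0..<m] @ [f m]) z)"
    unfolding forward_snoc sum_distrib_left by (rule sum.swap)
  finally show ?thesis by simp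
qed

section \<open>Polynomial functions on coordinate space\<close>

text \<open>
  Working with polynomial functions, instead of polynomials, makes determinants available without
  any arithmetic of monomials beyond \<open>polynomial_on_mult\<close>. A nonzero value of the function then
  certifies that a polynomial representing it is nonzero.
\<close>

definition polynomial_on :: "nat \<Rightarrow> (real vec \<Rightarrow> real) \<Rightarrow> bool" where
  "polynomial_on N g \<longleftrightarrow> (\<exists>f. mpoly_in N f \<and> (\<forall>x\<in>carrier_vec N. mpoly_eval f x = g x))"

lemma polynomial_on_cong:
  assumes "polynomial_on N g" and "\<And>x. x \<in> carrier_vec N \<Longrightarrow> g x = h x"
  shows "polynomial_on N h"
  using assms by (auto simp: polynomial_on_def)

text \<open>
  Evaluation over common index sets, which do not depend on the polynomial: this makes it visibly
  additive in the coefficients and multiplicative in the monomials.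
\<close>

lemma mpoly_eval_superset:
  assumes "mpoly_in N f" "finite K" "Poly_Mapping.keys f \<subseteq> K"
  shows "mpoly_eval f x = (\<Sum>m\<in>K. Poly_Mapping.lookup f m * (\<Prod>i<N. (x $ i) ^ Poly_Mapping.lookup m i))"
proof -
  have "mpoly_eval f x =
      (\<Sum>m\<in>Poly_Mapping.keys f. Poly_Mapping.lookup f m * (\<Prod>i<N. (x $ i) ^ Poly_Mapping.lookup m i))"
    unfolding mpoly_eval_def
  proof (intro sum.cong refl arg_cong2[where f = "(*)"] prod.mono_neutral_left)
    fix m assume "m \<in> Poly_Mapping.keys f"
    then show "Poly_Mapping.keys m \<subseteq> {..<N}" using assms(1) by (auto simp: mpoly_in_def)
  qed (auto simp: in_keys_iff)
  also have "\<dots> = (\<Sum>m\<in>K. Poly_Mapping.lookup f m * (\<Prod>i<N. (x $ i) ^ Poly_Mapping.lookup m i))"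
    using assms by (intro sum.mono_neutral_left) (auto simp: in_keys_iff)
  finally show ?thesis .
qed

lemma polynomial_on_monomial:
  assumes "Poly_Mapping.keys m \<subseteq> {..<N}"
  shows "polynomial_on N (\<lambda>x. c * (\<Prod>i<N. (x $ i) ^ Poly_Mapping.lookup m i))"
proof -
  have inN: "mpoly_in N (Poly_Mapping.single m c)" using assms by (auto simp: mpoly_in_def)
  show ?thesis
    unfolding polynomial_on_def
    using inN mpoly_eval_superset[OF inN, of "{m}"] by (intro exI[of _ "Poly_Mapping.single m c"]) auto
qed

lemma polynomial_on_const: "polynomial_on N (\<lambda>x. c)"
  using polynomial_on_monomial[of 0 N c] by simp

lemma polynomial_on_coordinate:
  assumes "n < N"
  shows "polynomial_on N (\<lambda>x. x $ n)"
proof -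
  have "(\<Prod>i<N. x $ i ^ Poly_Mapping.lookup (Poly_Mapping.single n 1) i) = x $ n" for x :: "real vec"
  proof -
    have "(\<Prod>i<N. x $ i ^ Poly_Mapping.lookup (Poly_Mapping.single n 1) i)
        = (\<Prod>i\<in>{n}. x $ i ^ Poly_Mapping.lookup (Poly_Mapping.single n 1) i)"
      using assms by (intro prod.mono_neutral_right) (auto simp: lookup_single)
    then show ?thesis by simp
  qed
  then show ?thesis
    using polynomial_on_monomial[of "Poly_Mapping.single n 1" N 1] assms by simp
qed

lemma polynomial_on_add:
  assumes "polynomial_on N g" "polynomial_on N h"
  shows "polynomial_on N (\<lambda>x. g x + h x)"
proof -
  obtain f1 f2 where f: "mpoly_in N f1" "\<forall>x\<in>carrier_vec N. mpoly_eval f1 x = g x"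
      "mpoly_in N f2" "\<forall>x\<in>carrier_vec N. mpoly_eval f2 x = h x"
    using assms by (auto simp: polynomial_on_def)
  let ?K = "Poly_Mapping.keys f1 \<union> Poly_Mapping.keys f2"
  have K: "Poly_Mapping.keys (f1 + f2) \<subseteq> ?K" by (rule keys_add)
  then have inN: "mpoly_in N (f1 + f2)" using f by (fastforce simp: mpoly_in_def)
  have "mpoly_eval (f1 + f2) x = mpoly_eval f1 x + mpoly_eval f2 x" for x
    using mpoly_eval_superset[OF inN, of ?K] mpoly_eval_superset[OF f(1), of ?K]
      mpoly_eval_superset[OF f(3), of ?K] K
    by (simp add: lookup_add distrib_right sum.distrib)
  then show ?thesis using f inN unfolding polynomial_on_def by (intro exI[of _ "f1 + f2"]) simp
qed

lemma polynomial_on_sum: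
  assumes "\<And>i. i \<in> I \<Longrightarrow> polynomial_on N (g i)"
  shows "polynomial_on N (\<lambda>x. \<Sum>i\<in>I. g i x)"
  using assms
  by (induction I rule: infinite_finite_induct) (auto intro: polynomial_on_const polynomial_on_add)

lemma polynomial_on_mult:
  assumes "polynomial_on N g" "polynomial_on N h"
  shows "polynomial_on N (\<lambda>x. g x * h x)"
proof -
  obtain f1 f2 where f: "mpoly_in N f1" "\<forall>x\<in>carrier_vec N. mpoly_eval f1 x = g x"
      "mpoly_in N f2" "\<forall>x\<in>carrier_vec N. mpoly_eval f2 x = h x"
    using assms by (auto simp: polynomial_on_def)
  let ?t = "\<lambda>m x. \<Prod>i<N. (x $ i) ^ Poly_Mapping.lookup m i"
  let ?s = "\<lambda>x. \<Sum>m\<in>Poly_Mapping.keys f1. \<Sum>n\<in>Poly_Mapping.keys f2.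
      (Poly_Mapping.lookup f1 m * Poly_Mapping.lookup f2 n) * ?t (m + n) x"
  have "polynomial_on N ?s"
  proof (intro polynomial_on_sum polynomial_on_monomial)
    fix m n assume "m \<in> Poly_Mapping.keys f1" "n \<in> Poly_Mapping.keys f2"
    then have "Poly_Mapping.keys m \<subseteq> {..<N}" "Poly_Mapping.keys n \<subseteq> {..<N}"
      using f(1,3) unfolding mpoly_in_def by blast+
    then show "Poly_Mapping.keys (m + n) \<subseteq> {..<N}"
      using keys_add[of m n] by blast
  qed
  moreover have "?s x = g x * h x" if "x \<in> carrier_vec N" for x
  proof -
    have "g x = (\<Sum>m\<in>Poly_Mapping.keys f1. Poly_Mapping.lookup f1 m * ?t m x)"
      using mpoly_eval_superset[OF f(1), of "Poly_Mapping.keys f1" x] f(2) that by simp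
    moreover have "h x = (\<Sum>m\<in>Poly_Mapping.keys f2. Poly_Mapping.lookup f2 m * ?t m x)"
      using mpoly_eval_superset[OF f(3), of "Poly_Mapping.keys f2" x] f(4) that by simp
    ultimately show ?thesis
      by (simp add: sum_product lookup_add power_add prod.distrib mult_ac)
  qed
  ultimately show ?thesis by (rule polynomial_on_cong)
qed

lemma polynomial_on_diff:
  assumes "polynomial_on N g" "polynomial_on N h"
  shows "polynomial_on N (\<lambda>x. g x - h x)"
  using polynomial_on_add[OF assms(1) polynomial_on_mult[OF polynomial_on_const[of N "- 1"] assms(2)]]
  by simp

lemma polynomial_on_prod:
  assumes "\<And>i. i \<in> I \<Longrightarrow> polynomial_on N (g i)"
  shows "polynomial_on N (\<lambda>x. \<Prod>i\<in>I. g i x)"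
  using assms
  by (induction I rule: infinite_finite_induct) (auto intro: polynomial_on_const polynomial_on_mult)

lemmas polynomial_on_intros = polynomial_on_const polynomial_on_coordinate polynomial_on_add
  polynomial_on_sum polynomial_on_mult polynomial_on_diff polynomial_on_prod

lemma polynomial_on_det:
  assumes "\<And>i j. i < n \<Longrightarrow> j < n \<Longrightarrow> polynomial_on N (\<lambda>x. M x $$ (i, j))"
    and "\<And>x. M x \<in> carrier_mat n n"
  shows "polynomial_on N (\<lambda>x. det (M x))"
  unfolding det_def'[OF assms(2)]
proof (intro polynomial_on_sum polynomial_on_mult polynomial_on_const polynomial_on_prod)
  fix \<sigma> i assume "\<sigma> \<in> {\<sigma>. \<sigma> permutes {0..<n}}" "i \<in> {0..<n}"
  then show "polynomial_on N (\<lambda>x. M x $$ (i, \<sigma> i))"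
    using permutes_in_image[of \<sigma> "{0..<n}" i] by (intro assms(1)) auto
qed

lemma tendsto_polynomial_on:
  assumes "polynomial_on N g" and x: "\<And>t. x t \<in> carrier_vec N" "y \<in> carrier_vec N"
    and lim: "\<And>n. n < N \<Longrightarrow> ((\<lambda>t. x t $ n) \<longlongrightarrow> y $ n) F"
  shows "((\<lambda>t. g (x t)) \<longlongrightarrow> g y) F"
proof -
  obtain f where f: "mpoly_in N f" "\<forall>x\<in>carrier_vec N. mpoly_eval f x = g x"
    using assms(1) by (auto simp: polynomial_on_def)
  have "((\<lambda>t. mpoly_eval f (x t)) \<longlongrightarrow> mpoly_eval f y) F"
    unfolding mpoly_eval_def using f(1)
    by (intro tendsto_sum tendsto_mult tendsto_const tendsto_prod tendsto_power lim)
      (auto simp: mpoly_in_def)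
  then show ?thesis using f x by simp
qed

lemma proper_subvariety_of_polynomial_on:
  assumes "polynomial_on N g" "x \<in> carrier_vec N" "g x \<noteq> 0"
  shows "proper_subvariety N {x \<in> carrier_vec N. g x = 0}"
proof -
  obtain f where f: "mpoly_in N f" "\<forall>x\<in>carrier_vec N. mpoly_eval f x = g x"
    using assms(1) by (auto simp: polynomial_on_def)
  have "f \<noteq> 0"
  proof
    assume "f = 0"
    then have "mpoly_eval f x = 0" by (simp add: mpoly_eval_def)
    with f(2) assms show False by simp
  qed
  with f show ?thesis unfolding proper_subvariety_def by (intro exI[of _ "{f}"]) auto
qed

section \<open>Separated words and a Vandermonde witness\<close>

text \<open>
  For words of length \<open>k\<close> no letter occurs more than \<open>k\<close> times, so the letter counts are the
  digits of this number in base \<open>k + 1\<close>. The weight thus encodes the multiset of letters.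
\<close>

definition digit_weight :: "nat \<Rightarrow> nat list \<Rightarrow> nat" where
  "digit_weight k v = (\<Sum>x\<leftarrow>v. (k + 1) ^ x)"

lemma digits_unique:
  assumes "length ms = length ns" "\<forall>m\<in>set ms. m < q" "\<forall>n\<in>set ns. n < (q::nat)"
    and "(\<Sum>i<length ms. ms ! i * q ^ i) = (\<Sum>i<length ns. ns ! i * q ^ i)"
  shows "ms = ns"
  using assms
proof (induction ms ns rule: list_induct2)
  case (Cons m ms n ns)
  have shift: "(\<Sum>i<length (x # xs). (x # xs) ! i * q ^ i) = x + q * (\<Sum>i<length xs. xs ! i * q ^ i)"
    for x and xs :: "nat list"
    by (simp only: length_Cons sum.lessThan_Suc_shift) (simp add: sum_distrib_left mult_ac)
  have eq: "m + q * (\<Sum>i<length ms. ms ! i * q ^ i) = n + q * (\<Sum>i<length ns. ns ! i * q ^ i)"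
    using Cons.prems(3) by (simp only: shift)
  have lt: "m < q" "n < q" using Cons.prems by auto
  have "m = n" using arg_cong[OF eq, of "\<lambda>t. t mod q"] lt by simp
  moreover from this have "(\<Sum>i<length ms. ms ! i * q ^ i) = (\<Sum>i<length ns. ns ! i * q ^ i)"
    using eq lt by simp
  ultimately show ?case using Cons by simp
qed simp

definition word_of_counts :: "nat list \<Rightarrow> nat list" where
  "word_of_counts ms = concat (map (\<lambda>l. replicate (ms ! l) l) [0..<length ms])"

lemma word_of_counts:
  assumes "length ms = \<kappa>" "sum_list ms = k"
  shows "word_of_counts ms \<in> words \<kappa> k"
    and "digit_weight k (word_of_counts ms) = (\<Sum>i<\<kappa>. ms ! i * (k + 1) ^ i)"
proof -
  have "length (word_of_counts ms) = (\<Sum>i<\<kappa>. ms ! i)"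
    using assms by (simp add: word_of_counts_def length_concat interv_sum_list_conv_sum_set_nat
        atLeast0LessThan o_def)
  then show "word_of_counts ms \<in> words \<kappa> k"
    using assms by (auto simp: words_def word_of_counts_def sum_list_sum_nth atLeast0LessThan)
  have "(\<Sum>x\<leftarrow>concat vs. (k + 1) ^ x) = (\<Sum>v\<leftarrow>vs. \<Sum>x\<leftarrow>v. (k + 1) ^ x)" for vs :: "nat list list"
    by (induction vs) auto
  then show "digit_weight k (word_of_counts ms) = (\<Sum>i<\<kappa>. ms ! i * (k + 1) ^ i)"
    using assms by (simp add: word_of_counts_def digit_weight_def interv_sum_list_conv_sum_set_nat
        atLeast0LessThan o_def sum_list_replicate)
qed

text \<open>
  The binomial coefficient counts the multisets of \<open>k\<close> letters out of \<open>\<kappa>\<close>. For the witness below,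
  words with the same multiset of letters are indistinguishable, so this is the number of words that
  can be told apart.
\<close>

lemma obtain_separated_words:
  assumes "1 \<le> \<kappa>" "r \<le> (k + \<kappa> - 1) choose (\<kappa> - 1)"
  obtains w where "\<And>j. j < r \<Longrightarrow> w j \<in> words \<kappa> k"
    and "inj_on (\<lambda>j. digit_weight k (w j)) {..<r}"
proof -
  let ?C = "{ms :: nat list. length ms = \<kappa> \<and> sum_list ms = k}"
  have card: "card ?C = (k + \<kappa> - 1) choose (\<kappa> - 1)"
    using assms(1) binomial_symmetric[of k "k + \<kappa> - 1"] by (simp add: card_length_sum_list)
  have inj: "inj_on (\<lambda>ms. digit_weight k (word_of_counts ms)) ?C"
  proof (rule inj_onI)
    fix ms ns assume C: "ms \<in> ?C" "ns \<in> ?C"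
      and eq: "digit_weight k (word_of_counts ms) = digit_weight k (word_of_counts ns)"
    have "\<forall>m\<in>set ms. m < k + 1" "\<forall>n\<in>set ns. n < k + 1"
      using C member_le_sum_list by (force simp: less_Suc_eq_le)+
    then show "ms = ns"
      using C eq word_of_counts(2)[of ms \<kappa> k] word_of_counts(2)[of ns \<kappa> k]
      by (intro digits_unique[of ms ns "k + 1"]) auto
  qed
  obtain ms where ms: "inj_on ms {..<r}" "ms ` {..<r} \<subseteq> ?C"
  proof (cases "r = 0")
    case False
    then have "finite ?C" using card assms(2) by (metis card.infinite le_0_eq)
    then have "\<exists>f. f ` {..<r} \<subseteq> ?C \<and> inj_on f {..<r}"
      using card assms(2) by (intro card_le_inj) auto
    then show ?thesis using that by blast
  qed (use that in auto)
  show thesis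
  proof (rule that[of "\<lambda>j. word_of_counts (ms j)"])
    show "word_of_counts (ms j) \<in> words \<kappa> k" if "j < r" for j
      using ms(2) that by (intro word_of_counts) auto
    show "inj_on (\<lambda>j. digit_weight k (word_of_counts (ms j))) {..<r}"
      using comp_inj_on[OF ms(1) inj_on_subset[OF inj ms(2)]] by (simp add: o_def)
  qed
qed

text \<open>
  When the hidden state never changes, the letters are independent given that state, and past and
  future likelihoods both become products of emission probabilities.
\<close>

lemma backward_identity:
  assumes "\<And>i j. i < r \<Longrightarrow> j < r \<Longrightarrow> a i j = (if i = j then 1 else 0)" "i < r"
  shows "backward r a b u i = (\<Prod>x\<leftarrow>u. b i x)"
  using assms(2)
proof (induction u arbitrary: i)
  case (Cons x u)
  have "backward r a b (x # u) i = (\<Sum>j<r. if j = i then b j x * backward r a b u j else 0)"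
    unfolding backward.simps using assms(1) Cons.prems by (intro sum.cong) auto
  then show ?case using Cons by simp
qed simp

lemma forward_identity:
  assumes "\<And>i j. i < r \<Longrightarrow> j < r \<Longrightarrow> a i j = (if i = j then 1 else 0)" "j < r"
  shows "forward r a b p u j = p j * (\<Prod>x\<leftarrow>u. b j x)"
  using assms(2)
proof (induction u arbitrary: p)
  case (Cons x u)
  have "(\<Sum>i<r. p i * b i x * a i j) = (\<Sum>i<r. if i = j then p i * b i x else 0)"
    using assms(1) Cons.prems by (intro sum.cong) auto
  then show ?case using Cons by simp
qed simp

text \<open>
  Up to normalisation of the rows, state \<open>i\<close> emits \<open>l\<close> with the \<open>i\<close>-th power of a number attached to
  \<open>l\<close>. Then the product over a word is the \<open>i\<close>-th power of a number attached to the word, namely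
  \<open>2\<close> to the power of its weight: the likelihoods form a Vandermonde matrix with rescaled columns.
\<close>

definition witness_emission :: "nat \<Rightarrow> nat \<Rightarrow> nat \<Rightarrow> nat \<Rightarrow> real" where
  "witness_emission \<kappa> k i l = (2 ^ (k + 1) ^ l) ^ i / (\<Sum>m<\<kappa>. (2 ^ (k + 1) ^ m) ^ i)"

lemma witness_denominator_pos:
  assumes "0 < \<kappa>"
  shows "0 < (\<Sum>m<\<kappa>. (2 ^ (k + 1) ^ m) ^ i :: real)"
  using assms by (intro sum_pos) auto

lemma sum_witness_emission:
  assumes "0 < \<kappa>"
  shows "(\<Sum>l<\<kappa>. witness_emission \<kappa> k i l) = 1"
  using witness_denominator_pos[OF assms, of k i]
  by (simp add: witness_emission_def sum_divide_distrib[symmetric])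

text \<open>
  A larger state favours the larger letters more strongly, so the normalised probability of the letter
  \<open>0\<close> strictly decreases. A second letter is needed for that, and so is \<open>k > 0\<close>, as all the weights
  coincide in base \<open>1\<close>.
\<close>

lemma inj_witness_emission:
  assumes "1 < \<kappa>" "0 < k"
  shows "inj (\<lambda>i. witness_emission \<kappa> k i 0)"
proof -
  let ?y = "\<lambda>l. 2 ^ (k + 1) ^ l :: real"
  have "witness_emission \<kappa> k j 0 < witness_emission \<kappa> k i 0" if "i < j" for i j
  proof -
    have le: "?y 0 ^ j * ?y l ^ i \<le> ?y 0 ^ i * ?y l ^ j" for l
    proof -
      have "?y 0 ^ (j - i) \<le> ?y l ^ (j - i)"
        by (intro power_mono power_increasing) auto
      then have "?y 0 ^ i * ?y l ^ i * ?y 0 ^ (j - i) \<le> ?y 0 ^ i * ?y l ^ i * ?y l ^ (j - i)"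
        by (intro mult_left_mono) auto
      moreover have "?y 0 ^ j = ?y 0 ^ i * ?y 0 ^ (j - i)" "?y l ^ j = ?y l ^ i * ?y l ^ (j - i)"
        using that by (simp_all only: power_add[symmetric] le_add_diff_inverse less_imp_le)
      ultimately show ?thesis by (simp only: mult_ac)
    qed
    have lt: "?y 0 ^ j * ?y 1 ^ i < ?y 0 ^ i * ?y 1 ^ j"
    proof -
      have "?y 0 ^ (j - i) < ?y 1 ^ (j - i)"
        using that assms by (intro power_strict_mono power_strict_increasing) auto
      then have "?y 0 ^ i * ?y 1 ^ i * ?y 0 ^ (j - i) < ?y 0 ^ i * ?y 1 ^ i * ?y 1 ^ (j - i)"
        by (intro mult_strict_left_mono) auto
      moreover have "?y 0 ^ j = ?y 0 ^ i * ?y 0 ^ (j - i)" "?y 1 ^ j = ?y 1 ^ i * ?y 1 ^ (j - i)"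
        using that by (simp_all only: power_add[symmetric] le_add_diff_inverse less_imp_le)
      ultimately show ?thesis by (simp only: mult_ac)
    qed
    have "?y 0 ^ j * (\<Sum>l<\<kappa>. ?y l ^ i) < ?y 0 ^ i * (\<Sum>l<\<kappa>. ?y l ^ j)"
      unfolding sum_distrib_left using assms le lt
      by (intro sum_strict_mono_ex1) (auto intro!: bexI[of _ 1])
    then show ?thesis
      using witness_denominator_pos[of \<kappa> k i] witness_denominator_pos[of \<kappa> k j] assms
      unfolding witness_emission_def by (simp only: divide_less_eq less_divide_eq) (simp add: field_simps)
  qed
  then show ?thesis by (intro linorder_injI) (metis less_irrefl)
qed

lemma prod_list_witness_emission:
  "(\<Prod>x\<leftarrow>v. witness_emission \<kappa> k i x)
    = (2 ^ digit_weight k v) ^ i * (1 / (\<Sum>m<\<kappa>. (2 ^ (k + 1) ^ m) ^ i)) ^ length v"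
  by (induction v)
    (simp_all add: digit_weight_def witness_emission_def power_add power_mult_distrib mult_ac)

text \<open>
  Nonsingularity of the Vandermonde matrix: a polynomial of degree less than \<open>r\<close> with \<open>r\<close> distinct
  roots is zero.
\<close>

lemma poly_vanishing_coeffs:
  fixes y c :: "nat \<Rightarrow> real"
  assumes "inj_on y {..<r}" and "\<And>j. j < r \<Longrightarrow> (\<Sum>i<r. c i * y j ^ i) = 0" and "i < r"
  shows "c i = 0"
proof -
  define P where "P = (\<Sum>i<r. monom (c i) i)"
  have coeff_P: "coeff P n = (if n < r then c n else 0)" for n
    by (simp add: P_def coeff_sum)
  have "P = 0"
  proof (rule ccontr)
    assume "P \<noteq> 0"
    have "y ` {..<r} \<subseteq> {x. poly P x = 0}"
      using assms(2) by (auto simp: P_def poly_sum poly_monom)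
    then have "card (y ` {..<r}) \<le> card {x. poly P x = 0}"
      using poly_roots_finite[OF \<open>P \<noteq> 0\<close>] by (intro card_mono)
    also have "\<dots> \<le> degree P" using \<open>P \<noteq> 0\<close> by (rule card_poly_roots_bound)
    finally have "r \<le> degree P" using assms(1) by (simp add: card_image)
    then have "coeff P (degree P) = 0" by (simp add: coeff_P)
    with \<open>P \<noteq> 0\<close> show False by simp
  qed
  then show ?thesis using coeff_P[of i] assms(3) by simp
qed

lemma det_witness:
  assumes "0 < \<kappa>" and w: "\<And>j. j < r \<Longrightarrow> w j \<in> words \<kappa> k"
    and inj: "inj_on (\<lambda>j. digit_weight k (w j)) {..<r}"
  shows "det (square r (\<lambda>j i. \<Prod>x\<leftarrow>w j. witness_emission \<kappa> k i x)) \<noteq> 0"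
  unfolding det_square_nonzero_iff
proof (intro allI impI)
  fix c n assume c: "\<forall>j<r. (\<Sum>i<r. (\<Prod>x\<leftarrow>w j. witness_emission \<kappa> k i x) * c i) = 0" and "n < r"
  define s where "s i = (1 / (\<Sum>m<\<kappa>. (2 ^ (k + 1) ^ m) ^ i :: real)) ^ k" for i
  have "c n * s n = 0"
  proof (rule poly_vanishing_coeffs[where y = "\<lambda>j. 2 ^ digit_weight k (w j)" and c = "\<lambda>i. c i * s i"])
    show "inj_on (\<lambda>j. 2 ^ digit_weight k (w j) :: real) {..<r}"
      using inj by (simp add: inj_on_def)
    show "(\<Sum>i<r. c i * s i * (2 ^ digit_weight k (w j)) ^ i) = 0" if "j < r" for j
    proof -
      have "length (w j) = k" using w[OF that] by (simp add: words_def)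
      then have "(\<Sum>i<r. c i * s i * (2 ^ digit_weight k (w j)) ^ i)
          = (\<Sum>i<r. (\<Prod>x\<leftarrow>w j. witness_emission \<kappa> k i x) * c i)"
        by (simp add: prod_list_witness_emission s_def mult_ac)
      then show ?thesis using c that by simp
    qed
  qed (fact \<open>n < r\<close>)
  moreover have "s n \<noteq> 0" using witness_denominator_pos[OF assms(1), of k n] by (simp add: s_def)
  ultimately show "c n = 0" by simp
qed

section \<open>The genericity polynomial\<close>

text \<open>
  Recovers the last entry of a row of sum \<open>1\<close> from the others. The next two definitions decode
  arbitrary coordinate vectors, also those that do not come from stochastic matrices, so that
  functions of the decoded matrices are polynomial on the whole space.
\<close>

definition complete_row :: "nat \<Rightarrow> (nat \<Rightarrow> real) \<Rightarrow> nat \<Rightarrow> real" where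
  "complete_row n y j = (if j < n - 1 then y j else 1 - (\<Sum>j<n - 1. y j))"

lemma complete_row_eq:
  assumes "(\<Sum>j<n. z j) = 1" "j < n" "\<And>j. j < n - 1 \<Longrightarrow> y j = z j"
  shows "complete_row n y j = z j"
proof (cases n)
  case (Suc m)
  then show ?thesis using assms by (cases "j = m") (auto simp: complete_row_def)
qed (use assms in simp)

definition transition_of :: "nat \<Rightarrow> real vec \<Rightarrow> nat \<Rightarrow> nat \<Rightarrow> real" where
  "transition_of r x i = complete_row r (\<lambda>j. x $ (i * (r - 1) + j))"

definition emission_of :: "nat \<Rightarrow> nat \<Rightarrow> real vec \<Rightarrow> nat \<Rightarrow> nat \<Rightarrow> real" where
  "emission_of r \<kappa> x i = complete_row \<kappa> (\<lambda>l. x $ (r * (r - 1) + (i * (\<kappa> - 1) + l)))"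

lemma index_bound:
  assumes "i < r" "j < (n :: nat)"
  shows "i * n + j < r * n"
proof -
  have "i * n + j < Suc i * n" using assms(2) by simp
  also have "\<dots> \<le> r * n" using assms(1) by (intro mult_le_mono1) simp
  finally show ?thesis .
qed

lemma coords_dim:
  fixes r \<kappa> :: nat
  assumes "1 \<le> r" "1 \<le> \<kappa>"
  shows "r * (r + \<kappa> - 2) = r * (r - 1) + r * (\<kappa> - 1)"
proof -
  have "r + \<kappa> - 2 = (r - 1) + (\<kappa> - 1)" using assms by simp
  then show ?thesis by (simp only: distrib_left)
qed

lemma transition_of_hmm_coords:
  assumes "1 \<le> r" "1 \<le> \<kappa>" "i < r" "j < r" "(\<Sum>j<r. A $$ (i, j)) = 1"
  shows "transition_of r (hmm_coords r \<kappa> A B) i j = A $$ (i, j)"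
  unfolding transition_of_def
proof (rule complete_row_eq[OF assms(5,4)])
  fix j assume "j < r - 1"
  then show "hmm_coords r \<kappa> A B $ (i * (r - 1) + j) = A $$ (i, j)"
    using index_bound[OF assms(3), of j "r - 1"]
    by (simp add: hmm_coords_def coords_dim[OF assms(1,2)])
qed

lemma emission_of_hmm_coords:
  assumes "1 \<le> r" "1 \<le> \<kappa>" "i < r" "l < \<kappa>" "(\<Sum>l<\<kappa>. B $$ (i, l)) = 1"
  shows "emission_of r \<kappa> (hmm_coords r \<kappa> A B) i l = B $$ (i, l)"
  unfolding emission_of_def
proof (rule complete_row_eq[OF assms(5,4)])
  fix l assume "l < \<kappa> - 1"
  then show "hmm_coords r \<kappa> A B $ (r * (r - 1) + (i * (\<kappa> - 1) + l)) = B $$ (i, l)"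
    using index_bound[OF assms(3), of l "\<kappa> - 1"]
    by (simp add: hmm_coords_def coords_dim[OF assms(1,2)])
qed

lemma polynomial_on_transition_of:
  assumes "1 \<le> r" "1 \<le> \<kappa>" "i < r"
  shows "polynomial_on (r * (r + \<kappa> - 2)) (\<lambda>x. transition_of r x i j)"
  unfolding transition_of_def complete_row_def coords_dim[OF assms(1,2)]
  using index_bound[OF assms(3), of _ "r - 1"]
  by (cases "j < r - 1") (auto intro!: polynomial_on_intros intro: trans_less_add1)

lemma polynomial_on_emission_of:
  assumes "1 \<le> r" "1 \<le> \<kappa>" "i < r"
  shows "polynomial_on (r * (r + \<kappa> - 2)) (\<lambda>x. emission_of r \<kappa> x i l)"
  unfolding emission_of_def complete_row_def coords_dim[OF assms(1,2)]
  using index_bound[OF assms(3), of _ "\<kappa> - 1"]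
  by (cases "l < \<kappa> - 1") (auto intro!: polynomial_on_intros)

lemma polynomial_on_backward:
  assumes "\<And>i j. i < r \<Longrightarrow> j < r \<Longrightarrow> polynomial_on N (\<lambda>x. a x i j)"
    and "\<And>i l. i < r \<Longrightarrow> polynomial_on N (\<lambda>x. b x i l)" and "i < r"
  shows "polynomial_on N (\<lambda>x. backward r (a x) (b x) u i)"
  using assms(3) by (induction u arbitrary: i) (auto intro!: polynomial_on_intros assms(1,2))

lemma polynomial_on_forward:
  assumes "\<And>i j. i < r \<Longrightarrow> j < r \<Longrightarrow> polynomial_on N (\<lambda>x. a x i j)"
    and "\<And>i l. i < r \<Longrightarrow> polynomial_on N (\<lambda>x. b x i l)"
    and "\<And>i. i < r \<Longrightarrow> polynomial_on N (\<lambda>x. p x i)" and "j < r"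
  shows "polynomial_on N (\<lambda>x. forward r (a x) (b x) (p x) u j)"
  using assms(3)
proof (induction u arbitrary: p)
  case (Cons y u)
  show ?case
    unfolding forward.simps
    by (rule Cons.IH) (auto intro!: polynomial_on_intros assms(1,2) Cons.prems)
qed (use assms(4) in simp)

lemma polynomial_on_det_square:
  assumes "\<And>i j. i < n \<Longrightarrow> j < n \<Longrightarrow> polynomial_on N (\<lambda>x. f x i j)"
  shows "polynomial_on N (\<lambda>x. det (square n (f x)))"
  using assms by (intro polynomial_on_det[where n = n]) (auto simp: square_def)

lemma polynomial_on_adj_mat:
  assumes "\<And>i j. i < n \<Longrightarrow> j < n \<Longrightarrow> polynomial_on N (\<lambda>x. f x i j)" and "i < n" "j < n"
  shows "polynomial_on N (\<lambda>x. adj_mat (square n (f x)) $$ (i, j))"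
proof -
  have "polynomial_on N (\<lambda>x. (- 1) ^ (j + i) * det (mat_delete (square n (f x)) j i))"
    by (intro polynomial_on_intros polynomial_on_det[where n = "n - 1"])
      (auto simp: mat_delete_def square_def intro!: assms(1))
  then show ?thesis using assms(2,3) by (simp add: adj_mat_def cofactor_def square_def)
qed

text \<open>
  The last column of \<open>1 - a\<close>, which the others determine when the rows of \<open>a\<close> have sum \<open>1\<close>, is
  replaced by ones, so that the linear equations of a stationary distribution include its normalisation.
\<close>

definition normalised_generator :: "nat \<Rightarrow> (nat \<Rightarrow> nat \<Rightarrow> real) \<Rightarrow> nat \<Rightarrow> nat \<Rightarrow> real" where
  "normalised_generator r a i j = (if j = r - 1 then 1 else (if i = j then 1 else 0) - a i j)"

text \<open>
  The stationary distribution is in general only a rational function of the transition matrix. This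
  is the polynomial multiple of it that Cramer's rule gives.
\<close>

definition stationary_cofactors :: "nat \<Rightarrow> (nat \<Rightarrow> nat \<Rightarrow> real) \<Rightarrow> nat \<Rightarrow> real" where
  "stationary_cofactors r a i = adj_mat (square r (normalised_generator r a)) $$ (r - 1, i)"

text \<open>
  Stationarity and normalisation say that \<open>p\<close> times the normalised generator is the last unit row
  vector. Multiplication by the adjugate from the right gives \<open>p\<close> times the determinant on one side
  and the last row of the adjugate on the other.
\<close>

lemma stationary_cofactors_eq:
  assumes p: "\<And>j. j < r \<Longrightarrow> (\<Sum>i<r. p i * a i j) = p j" "(\<Sum>i<r. p i) = 1" and "j < r"
  shows "stationary_cofactors r a j = det (square r (normalised_generator r a)) * p j"
proof -
  let ?M = "normalised_generator r a" and ?adj = "adj_mat (square r (normalised_generator r a))"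
  have pM: "(\<Sum>i<r. p i * ?M i n) = (if n = r - 1 then 1 else 0)" if "n < r" for n
  proof (cases "n = r - 1")
    case False
    have "(\<Sum>i<r. p i * ?M i n) = (\<Sum>i<r. (if i = n then p i else 0) - p i * a i n)"
      using False by (intro sum.cong) (auto simp: normalised_generator_def algebra_simps)
    then show ?thesis using False that p(1)[OF that] by (simp add: sum_subtractf)
  qed (simp add: normalised_generator_def p(2))
  have adj: "?adj \<in> carrier_mat r r" "square r ?M * ?adj = det (square r ?M) \<cdot>\<^sub>m 1\<^sub>m r"
    using adj_mat[OF square_carrier[of r ?M]] by auto
  have M_adj: "(\<Sum>n<r. ?M i n * ?adj $$ (n, j)) = (if i = j then det (square r ?M) else 0)"
    if "i < r" for i
  proof -
    have "(\<Sum>n<r. ?M i n * ?adj $$ (n, j)) = (square r ?M * ?adj) $$ (i, j)"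
      using that \<open>j < r\<close> adj(1) by (simp add: square_def scalar_prod_def atLeast0LessThan)
    then show ?thesis using that \<open>j < r\<close> by (simp add: adj(2))
  qed
  have "stationary_cofactors r a j = (\<Sum>n<r. (if n = r - 1 then 1 else 0) * ?adj $$ (n, j))"
    using \<open>j < r\<close> by (simp add: stationary_cofactors_def if_distrib[of "\<lambda>t. t * _"] cong: if_cong)
  also have "\<dots> = (\<Sum>n<r. (\<Sum>i<r. p i * ?M i n) * ?adj $$ (n, j))"
    using pM by simp
  also have "\<dots> = (\<Sum>i<r. p i * (\<Sum>n<r. ?M i n * ?adj $$ (n, j)))"
    unfolding sum_distrib_left sum_distrib_right by (subst sum.swap) (simp add: mult.assoc)
  also have "\<dots> = (\<Sum>i<r. if i = j then det (square r ?M) * p i else 0)"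
    using M_adj by (intro sum.cong) auto
  finally show ?thesis using \<open>j < r\<close> by simp
qed

lemma det_square_scale: "det (square r (\<lambda>i j. t * f i j)) = t ^ r * det (square r f)"
proof -
  have "square r (\<lambda>i j. t * f i j) = t \<cdot>\<^sub>m square r f"
    by (rule eq_matI) (auto simp: square_def)
  then show ?thesis by (simp add: square_def)
qed

text \<open>
  By homogeneity the forward determinant of the cofactors is nonzero only if that of the stationary
  distribution is nonzero.
\<close>

lemma det_forward_stationary_cofactors:
  assumes "\<And>j. j < r \<Longrightarrow> (\<Sum>i<r. p i * a i j) = p j" "(\<Sum>i<r. p i) = 1"
  shows "det (square r (\<lambda>j. forward r a b (stationary_cofactors r a) (w j)))
    = det (square r (normalised_generator r a)) ^ r * det (square r (\<lambda>j. forward r a b p (w j)))"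
proof -
  have "square r (\<lambda>j. forward r a b (stationary_cofactors r a) (w j))
    = square r (\<lambda>j i. det (square r (normalised_generator r a)) * forward r a b p (w j) i)"
    unfolding forward_smult[symmetric]
    by (intro square_cong forward_cong stationary_cofactors_eq assms) auto
  then show ?thesis by (simp add: det_square_scale)
qed

text \<open>
  The polynomial whose zero set is the exceptional variety: where its three factors do not vanish,
  the three nondegeneracy hypotheses of \<open>hmm_uniqueness\<close> hold, the one on \<open>forward\<close> by
  \<open>det_forward_stationary_cofactors\<close>. The words \<open>w\<close> select one maximal minor of the past and of the
  future likelihoods.
\<close>

definition genericity :: "nat \<Rightarrow> (nat \<Rightarrow> nat list) \<Rightarrow> (nat \<Rightarrow> nat \<Rightarrow> real) \<Rightarrow> (nat \<Rightarrow> nat \<Rightarrow> real) \<Rightarrow> real"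
where
  "genericity r w a b = det (square r (\<lambda>j. backward r a b (w j)))
     * det (square r (\<lambda>j. forward r a b (stationary_cofactors r a) (w j)))
     * (\<Prod>i<r. \<Prod>j<i. b i 0 - b j 0)"

lemma polynomial_on_genericity:
  assumes "1 \<le> r" "1 \<le> \<kappa>"
  shows "polynomial_on (r * (r + \<kappa> - 2))
    (\<lambda>x. genericity r w (transition_of r x) (emission_of r \<kappa> x))"
proof -
  note pa = polynomial_on_transition_of[OF assms] and pb = polynomial_on_emission_of[OF assms]
  have pM: "polynomial_on (r * (r + \<kappa> - 2)) (\<lambda>x. normalised_generator r (transition_of r x) i j)"
    if "i < r" for i j
  proof (cases "j = r - 1")
    case False
    then show ?thesis
      by (simp only: normalised_generator_def if_False)
        (intro polynomial_on_diff polynomial_on_const pa that)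
  qed (simp add: normalised_generator_def polynomial_on_const)
  show ?thesis
    unfolding genericity_def
  proof (intro polynomial_on_mult polynomial_on_det_square polynomial_on_prod polynomial_on_diff
      polynomial_on_backward polynomial_on_forward pa pb)
    show "polynomial_on (r * (r + \<kappa> - 2)) (\<lambda>x. stationary_cofactors r (transition_of r x) i)"
      if "i < r" for i
      unfolding stationary_cofactors_def using that pM assms(1) by (intro polynomial_on_adj_mat) auto
  qed auto
qed

lemma genericity_cong:
  assumes a: "\<And>i j. i < r \<Longrightarrow> j < r \<Longrightarrow> a i j = a' i j"
    and b: "\<And>i l. i < r \<Longrightarrow> l < \<kappa> \<Longrightarrow> b i l = b' i l"
    and w: "\<And>j. j < r \<Longrightarrow> w j \<in> words \<kappa> k" and "0 < \<kappa>"
  shows "genericity r w a b = genericity r w a' b'"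
proof -
  have letters: "\<And>j x. j < r \<Longrightarrow> x \<in> set (w j) \<Longrightarrow> x < \<kappa>" using w by (auto simp: words_def)
  have "square r (normalised_generator r a) = square r (normalised_generator r a')"
    by (rule square_cong) (simp add: normalised_generator_def a)
  then have c: "stationary_cofactors r a = stationary_cofactors r a'"
    by (simp add: stationary_cofactors_def fun_eq_iff)
  have "square r (\<lambda>j. backward r a b (w j)) = square r (\<lambda>j. backward r a' b' (w j))"
    using a b letters by (intro square_cong backward_cong) auto
  moreover have "square r (\<lambda>j. forward r a b (stationary_cofactors r a) (w j))
      = square r (\<lambda>j. forward r a' b' (stationary_cofactors r a') (w j))"
    using a b c letters by (intro square_cong forward_cong) auto
  moreover have "(\<Prod>i<r. \<Prod>j<i. b i 0 - b j 0) = (\<Prod>i<r. \<Prod>j<i. b' i 0 - b' j 0)"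
    using b \<open>0 < \<kappa>\<close> by (intro prod.cong) auto
  ultimately show ?thesis by (simp add: genericity_def)
qed

lemma prod_differences_nonzero_iff:
  fixes y :: "nat \<Rightarrow> real"
  shows "(\<Prod>i<r. \<Prod>j<i. y i - y j) \<noteq> 0 \<longleftrightarrow> inj_on y {..<r}"
proof
  assume nz: "(\<Prod>i<r. \<Prod>j<i. y i - y j) \<noteq> 0"
  have "y i \<noteq> y j" if "j < i" "i < r" for i j
    using nz that by (fastforce simp: prod_zero_iff)
  then show "inj_on y {..<r}"
    by (intro linorder_inj_onI) (auto, metis)
next
  assume "inj_on y {..<r}"
  then show "(\<Prod>i<r. \<Prod>j<i. y i - y j) \<noteq> 0"
    by (auto simp: prod_zero_iff dest: inj_onD)
qed

text \<open>
  A chain that is stationary under the uniform distribution and tends to the identity. The identity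
  itself is no witness: every distribution is stationary under it, and for \<open>r > 1\<close> its normalised
  generator is singular.
\<close>

definition lazy_uniform :: "nat \<Rightarrow> real \<Rightarrow> nat \<Rightarrow> nat \<Rightarrow> real" where
  "lazy_uniform r \<epsilon> i j = (if i = j then 1 - \<epsilon> else 0) + \<epsilon> / real r"

lemma sum_lazy_uniform:
  assumes "j < r"
  shows "(\<Sum>i<r. lazy_uniform r \<epsilon> i j) = 1" and "(\<Sum>i<r. lazy_uniform r \<epsilon> j i) = 1"
  using assms by (simp_all add: lazy_uniform_def sum.distrib)

lemma det_normalised_generator_lazy_uniform:
  assumes "1 \<le> r" "\<epsilon> \<noteq> 0"
  shows "det (square r (normalised_generator r (lazy_uniform r \<epsilon>))) \<noteq> 0"
  unfolding det_square_nonzero_iff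
proof (intro allI impI)
  fix c j assume c: "\<forall>i<r. (\<Sum>j<r. normalised_generator r (lazy_uniform r \<epsilon>) i j * c j) = 0"
    and "j < r"
  \<comment> \<open>the column of ones makes the last entry of \<open>c\<close> a constant added to each row; the other entries
    are acted on by \<open>\<epsilon>\<close> times the projection to vectors of mean \<open>0\<close>\<close>
  define d where "d j = (if j = r - 1 then 0 else c j)" for j
  define m where "m = (\<Sum>j<r. d j) / real r"
  have row: "\<epsilon> * (d i - m) + c (r - 1) = 0" if "i < r" for i
  proof -
    have "(\<Sum>j<r. normalised_generator r (lazy_uniform r \<epsilon>) i j * c j)
      = (\<Sum>j<r. (if j = i then \<epsilon> * d j else 0) - \<epsilon> / real r * d j
          + (if j = r - 1 then c j else 0))"
      by (intro sum.cong) (auto simp: normalised_generator_def lazy_uniform_def d_def algebra_simps)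
    also have "\<dots> = \<epsilon> * d i - \<epsilon> / real r * (\<Sum>j<r. d j) + c (r - 1)"
      using that assms(1) by (simp add: sum.distrib sum_subtractf sum_distrib_left)
    finally show ?thesis using c that by (simp add: m_def algebra_simps)
  qed
  have "d (r - 1) = 0" by (simp add: d_def)
  then have last: "c (r - 1) = \<epsilon> * m" using row[of "r - 1"] assms(1) by simp
  then have d: "d i = 0" if "i < r" for i
    using row[OF that] assms(2) by (simp add: algebra_simps)
  then have "m = 0" by (simp add: m_def)
  then show "c j = 0" using last d[OF \<open>j < r\<close>] by (cases "j = r - 1") (auto simp: d_def)
qed

text \<open>
  Take \<open>witness_emission\<close>, for which the product of differences is nonzero (and empty if \<open>r = 1\<close>). At
  the identity transition matrix, the backward determinant and the forward determinant started from
  constant weights both equal the determinant in \<open>det_witness\<close>, hence they remain nonzero for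
  \<open>lazy_uniform r \<epsilon>\<close> with small \<open>\<epsilon> > 0\<close>. There the stationary cofactors are constant, and nonzero,
  so that the constant weights may be replaced by them.
\<close>

lemma exists_generic_point:
  assumes r: "1 \<le> r" and \<kappa>: "1 \<le> \<kappa>" and distinct: "r = 1 \<or> (1 < \<kappa> \<and> 0 < k)"
    and w: "\<And>j. j < r \<Longrightarrow> w j \<in> words \<kappa> k"
    and inj: "inj_on (\<lambda>j. digit_weight k (w j)) {..<r}"
  shows "\<exists>x\<in>carrier_vec (r * (r + \<kappa> - 2)).
    genericity r w (transition_of r x) (emission_of r \<kappa> x) \<noteq> 0"
proof -
  let ?N = "r * (r + \<kappa> - 2)"
  let ?b = "witness_emission \<kappa> k"
  define x where "x \<epsilon> = hmm_coords r \<kappa> (mat r r (\<lambda>(i, j). lazy_uniform r \<epsilon> i j))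
      (mat r \<kappa> (\<lambda>(i, l). ?b i l))" for \<epsilon>
  have x_carrier: "x \<epsilon> \<in> carrier_vec ?N" for \<epsilon> by (simp add: x_def hmm_coords_def)
  have a_x: "transition_of r (x \<epsilon>) i j = lazy_uniform r \<epsilon> i j" if "i < r" "j < r" for \<epsilon> i j
    unfolding x_def using that r \<kappa> sum_lazy_uniform
    by (subst transition_of_hmm_coords) auto
  have b_x: "emission_of r \<kappa> (x \<epsilon>) i l = ?b i l" if "i < r" "l < \<kappa>" for \<epsilon> i l
    unfolding x_def using that r \<kappa> sum_witness_emission
    by (subst emission_of_hmm_coords) auto
  have x_lim: "((\<lambda>\<epsilon>. x \<epsilon> $ n) \<longlongrightarrow> x 0 $ n) (at_right 0)" if "n < ?N" for n
  proof (cases "n < r * (r - 1)")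
    case True
    then have "r - 1 > 0" by (cases "r - 1 = 0") auto
    then have ij: "n div (r - 1) < r" "n mod (r - 1) < r"
      using True by (auto simp: less_mult_imp_div_less intro: less_le_trans[OF mod_less_divisor])
    have "((\<lambda>\<epsilon>. lazy_uniform r \<epsilon> i j) \<longlongrightarrow> lazy_uniform r 0 i j) (at_right 0)" for i j
      using r unfolding lazy_uniform_def by (cases "i = j") (auto intro!: tendsto_eq_intros)
    then show ?thesis using True that ij by (simp add: x_def hmm_coords_def)
  next
    case False
    then show ?thesis using that by (simp add: x_def hmm_coords_def)
  qed
  have letters: "\<And>j y. j < r \<Longrightarrow> y \<in> set (w j) \<Longrightarrow> y < \<kappa>" using w by (auto simp: words_def)
  note pa = polynomial_on_transition_of[OF r \<kappa>] and pb = polynomial_on_emission_of[OF r \<kappa>]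
  define backward_det where "backward_det x =
      det (square r (\<lambda>j. backward r (transition_of r x) (emission_of r \<kappa> x) (w j)))" for x
  define forward_det where "forward_det x =
      det (square r (\<lambda>j. forward r (transition_of r x) (emission_of r \<kappa> x) (\<lambda>_. 1) (w j)))" for x
  have id: "transition_of r (x 0) i j = (if i = j then 1 else 0)" if "i < r" "j < r" for i j
    using a_x[OF that, of 0] by (simp add: lazy_uniform_def)
  have emit: "(\<Prod>y\<leftarrow>w j. emission_of r \<kappa> (x 0) i y) = (\<Prod>y\<leftarrow>w j. ?b i y)" if "i < r" "j < r" for i j
    using b_x letters that by (intro arg_cong[where f = prod_list] map_cong) auto
  have "backward_det (x 0) \<noteq> 0" "forward_det (x 0) \<noteq> 0"
  proof -
    have "square r (\<lambda>j. backward r (transition_of r (x 0)) (emission_of r \<kappa> (x 0)) (w j))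
        = square r (\<lambda>j i. \<Prod>y\<leftarrow>w j. ?b i y)"
      by (intro square_cong) (simp add: backward_identity[of r, OF id] emit)
    moreover have "square r (\<lambda>j. forward r (transition_of r (x 0)) (emission_of r \<kappa> (x 0)) (\<lambda>_. 1) (w j))
        = square r (\<lambda>j i. \<Prod>y\<leftarrow>w j. ?b i y)"
      by (intro square_cong) (simp add: forward_identity[of r, OF id] emit)
    ultimately show "backward_det (x 0) \<noteq> 0" "forward_det (x 0) \<noteq> 0"
      unfolding backward_det_def forward_det_def using det_witness[OF _ w inj] \<kappa> by simp_all
  qed
  moreover have "polynomial_on ?N backward_det" "polynomial_on ?N forward_det"
    unfolding backward_det_def forward_det_def
    by (auto intro!: polynomial_on_det_square polynomial_on_backward polynomial_on_forward
        polynomial_on_const pa pb)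
  moreover have "\<forall>\<^sub>F \<epsilon> in at_right 0. g (x \<epsilon>) \<noteq> 0" if "polynomial_on ?N g" "g (x 0) \<noteq> 0" for g
    using tendsto_polynomial_on[OF that(1) x_carrier x_carrier x_lim] that(2)
    by (rule tendsto_imp_eventually_ne)
  ultimately have "\<forall>\<^sub>F \<epsilon> in at_right 0. backward_det (x \<epsilon>) \<noteq> 0"
    "\<forall>\<^sub>F \<epsilon> in at_right 0. forward_det (x \<epsilon>) \<noteq> 0"
    by blast+
  then have "\<forall>\<^sub>F \<epsilon> in at_right 0. 0 < \<epsilon> \<and> backward_det (x \<epsilon>) \<noteq> 0 \<and> forward_det (x \<epsilon>) \<noteq> 0"
    using eventually_at_right_less[of "0 :: real"] by eventually_elim simp
  then obtain \<epsilon> :: real where \<epsilon>: "0 < \<epsilon>" "backward_det (x \<epsilon>) \<noteq> 0" "forward_det (x \<epsilon>) \<noteq> 0"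
    using eventually_happens'[OF trivial_limit_at_right_real] by blast
  let ?a = "lazy_uniform r \<epsilon>"
  have "det (square r (\<lambda>j. forward r ?a ?b (stationary_cofactors r ?a) (w j))) \<noteq> 0"
  proof -
    have "square r (\<lambda>j. forward r ?a ?b (\<lambda>_. 1 / real r) (w j))
        = square r (\<lambda>j i. 1 / real r * forward r ?a ?b (\<lambda>_. 1) (w j) i)"
      using forward_smult[of r ?a ?b "1 / real r" "\<lambda>_. 1"] by (intro square_cong) simp
    then have uniform: "det (square r (\<lambda>j. forward r ?a ?b (\<lambda>_. 1 / real r) (w j)))
        = (1 / real r) ^ r * det (square r (\<lambda>j. forward r ?a ?b (\<lambda>_. 1) (w j)))"
      by (simp only: det_square_scale)
    have "square r (\<lambda>j. forward r ?a ?b (\<lambda>_. 1) (w j)) =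
        square r (\<lambda>j. forward r (transition_of r (x \<epsilon>)) (emission_of r \<kappa> (x \<epsilon>)) (\<lambda>_. 1) (w j))"
      using a_x b_x letters by (intro square_cong forward_cong) auto
    then have "det (square r (\<lambda>j. forward r ?a ?b (\<lambda>_. 1) (w j))) \<noteq> 0"
      using \<epsilon>(3) by (simp add: forward_det_def)
    moreover have "(\<Sum>i<r. 1 / real r * ?a i j) = 1 / real r" if "j < r" for j
      using sum_lazy_uniform(1)[OF that, of \<epsilon>] by (simp only: sum_distrib_left[symmetric] mult_1_right)
    ultimately show ?thesis
      using det_forward_stationary_cofactors[where r = r and p = "\<lambda>_. 1 / real r" and a = ?a and b = ?b and w = w] r
        det_normalised_generator_lazy_uniform[OF r, of \<epsilon>] \<epsilon>(1)
      by (simp add: uniform)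
  qed
  moreover have "det (square r (\<lambda>j. backward r ?a ?b (w j))) \<noteq> 0"
  proof -
    have "square r (\<lambda>j. backward r ?a ?b (w j)) =
        square r (\<lambda>j. backward r (transition_of r (x \<epsilon>)) (emission_of r \<kappa> (x \<epsilon>)) (w j))"
      using a_x b_x letters by (intro square_cong backward_cong) auto
    then show ?thesis using \<epsilon>(2) by (simp add: backward_det_def)
  qed
  moreover have "inj_on (\<lambda>i. ?b i 0) {..<r}"
    using distinct inj_witness_emission[of \<kappa> k]
    by (auto simp: inj_on_def inj_def lessThan_Suc)
  ultimately have "genericity r w ?a ?b \<noteq> 0"
    unfolding genericity_def using prod_differences_nonzero_iff[where r = r and y = "\<lambda>i. ?b i 0"] by simp
  moreover have "genericity r w (transition_of r (x \<epsilon>)) (emission_of r \<kappa> (x \<epsilon>)) = genericity r w ?a ?b"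
    using a_x b_x w \<kappa> by (intro genericity_cong[where \<kappa> = \<kappa> and k = k]) auto
  ultimately show ?thesis using x_carrier by metis
qed

section \<open>Generic identifiability\<close>

lemma hmm_params_stationary:
  assumes "(A, B) \<in> hmm_params r \<kappa>"
  obtains p where "(THE p. stationary_vec A p) = p" "prob_vec p" "dim_vec p = r"
    "\<And>j. j < r \<Longrightarrow> (\<Sum>i<r. p $ i * A $$ (i, j)) = p $ j" "(\<Sum>i<r. p $ i) = 1"
proof -
  have A: "A \<in> carrier_mat r r" and ex: "\<exists>!p. stationary_vec A p"
    using assms by (auto simp: hmm_params_def)
  define p where "p = (THE p. stationary_vec A p)"
  have st: "stationary_vec A p" unfolding p_def by (rule theI'[OF ex])
  then have dim: "dim_vec p = r" and fixed: "A\<^sup>T *\<^sub>v p = p" and pv: "prob_vec p"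
    using A by (auto simp: stationary_vec_def prob_vec_def)
  have "(\<Sum>i<r. p $ i * A $$ (i, j)) = p $ j" if "j < r" for j
  proof -
    have "(\<Sum>i<r. p $ i * A $$ (i, j)) = (A\<^sup>T *\<^sub>v p) $ j"
      using that A dim by (simp add: scalar_prod_def atLeast0LessThan mult.commute)
    then show ?thesis by (simp add: fixed)
  qed
  then show thesis using that[of p] dim pv by (simp add: p_def[symmetric] prob_vec_def)
qed

lemma word_law_of_hmm_pmf:
  assumes "(A, B) \<in> hmm_params r \<kappa>" "p = (THE p. stationary_vec A p)" "v \<in> words \<kappa> (Suc m)"
  shows "(\<Sum>z<r. forward r (\<lambda>i j. A $$ (i, j)) (\<lambda>i l. B $$ (i, l)) (($) p) v z)
    = pmf (hmm_pmf A B m) (\<lambda>i. if i \<le> m then v ! i else 0)"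
proof -
  let ?f = "\<lambda>i. if i \<le> m then v ! i else 0"
  have v: "length v = Suc m" "set v \<subseteq> {..<\<kappa>}" using assms(3) by (auto simp: words_def)
  have "map ?f [0..<Suc m] = v" using v(1) by (intro nth_equalityI) (auto simp del: upt_Suc)
  moreover have "?f i < \<kappa>" if "i \<le> m" for i
    using v that nth_mem[of i v] by force
  moreover obtain q where "(THE p. stationary_vec A p) = q" "prob_vec q" "dim_vec q = r"
    using hmm_params_stationary[OF assms(1)] by blast
  ultimately show ?thesis
    using assms(1,2) pmf_hmm_pmf[of A r B \<kappa> p m ?f] by (auto simp: hmm_params_def)
qed

lemma label_swap_eqI:
  assumes \<sigma>: "\<sigma> permutes {..<r}"
    and mats: "A \<in> carrier_mat r r" "B \<in> carrier_mat r \<kappa>" "A' \<in> carrier_mat r r" "B' \<in> carrier_mat r \<kappa>"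
    and A': "\<And>i j. i < r \<Longrightarrow> j < r \<Longrightarrow> A' $$ (i, j) = A $$ (\<sigma> i, \<sigma> j)"
    and B': "\<And>i l. i < r \<Longrightarrow> l < \<kappa> \<Longrightarrow> B' $$ (i, l) = B $$ (\<sigma> i, l)"
  shows "label_swap_eq r (A, B) (A', B')"
proof -
  let ?P = "mat r r (\<lambda>(i, j). if j = \<sigma> i then 1 else 0 :: real)"
  have \<sigma>_lt: "\<sigma> i < r" if "i < r" for i
    using permutes_in_image[OF \<sigma>, of i] that by simp
  have select: "(\<Sum>n<r. (if n = \<sigma> i then 1 else 0) * g n) = g (\<sigma> i)" if "i < r" for i and g :: "nat \<Rightarrow> real"
    using \<sigma>_lt[OF that] by (simp add: if_distrib[of "\<lambda>t. t * _"] cong: if_cong)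
  have PX: "(?P * X) $$ (i, j) = X $$ (\<sigma> i, j)" if "X \<in> carrier_mat r n" "i < r" "j < n" for X i j n
    using that select[of i "\<lambda>m. X $$ (m, j)"]
    by (simp add: scalar_prod_def atLeast0LessThan)
  have "A' = ?P * A * ?P\<^sup>T"
  proof (rule eq_matI)
    fix i j assume ij: "i < dim_row (?P * A * ?P\<^sup>T)" "j < dim_col (?P * A * ?P\<^sup>T)"
    then have lt: "i < r" "j < r" by auto
    have "(?P * A * ?P\<^sup>T) $$ (i, j) = (\<Sum>n<r. (?P * A) $$ (i, n) * ?P $$ (j, n))"
      using lt mats(1) by (simp add: scalar_prod_def atLeast0LessThan)
    also have "\<dots> = (\<Sum>n<r. (if n = \<sigma> j then 1 else 0) * A $$ (\<sigma> i, n))"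
      using PX[OF mats(1) lt(1)] lt by (intro sum.cong) auto
    also have "\<dots> = A $$ (\<sigma> i, \<sigma> j)" by (rule select[OF lt(2)])
    finally show "A' $$ (i, j) = (?P * A * ?P\<^sup>T) $$ (i, j)" using A' lt by simp
  qed (use mats in auto)
  moreover have "B' = ?P * B"
    using mats PX[OF mats(2)] B' by (intro eq_matI) auto
  ultimately show ?thesis
    using \<sigma> by (auto simp: label_swap_eq_def permutation_mat_def)
qed

theorem theorem6:
  fixes r \<kappa> k :: nat
  assumes "r \<ge> 1" and "\<kappa> \<ge> 1"
    and "(k + \<kappa> - 1) choose (\<kappa> - 1) \<ge> r"
  shows "hmm_generically_identifiable r \<kappa> (2 * k)"
proof -
  let ?N = "r * (r + \<kappa> - 2)"
  obtain w where w: "\<And>j. j < r \<Longrightarrow> w j \<in> words \<kappa> k"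
    and inj: "inj_on (\<lambda>j. digit_weight k (w j)) {..<r}"
    using obtain_separated_words[OF assms(2,3)] by blast
  \<comment> \<open>for a single letter or empty words the binomial coefficient is \<open>1\<close>\<close>
  have small: "r = 1 \<or> (1 < \<kappa> \<and> 0 < k)"
  proof (cases "\<kappa> = 1 \<or> k = 0")
    case True
    then show ?thesis using assms by auto
  qed (use assms(2) in auto)
  define g where "g x = genericity r w (transition_of r x) (emission_of r \<kappa> x)" for x
  obtain x where "x \<in> carrier_vec ?N" "g x \<noteq> 0"
    using exists_generic_point[OF assms(1,2) small w inj] unfolding g_def by blast
  then have "proper_subvariety ?N {x \<in> carrier_vec ?N. g x = 0}"
    using polynomial_on_genericity[OF assms(1,2)] unfolding g_def
    by (intro proper_subvariety_of_polynomial_on) auto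
  moreover have "label_swap_eq r (A, B) (A', B')"
    if AB: "(A, B) \<in> hmm_params r \<kappa>" and AB': "(A', B') \<in> hmm_params r \<kappa>"
      and generic: "hmm_coords r \<kappa> A B \<notin> {x \<in> carrier_vec ?N. g x = 0}"
      and law: "hmm_pmf A' B' (2 * k) = hmm_pmf A B (2 * k)" for A B A' B'
  proof -
    define a b a' b' where ab: "a = (\<lambda>i j. A $$ (i, j))" "b = (\<lambda>i l. B $$ (i, l))"
      "a' = (\<lambda>i j. A' $$ (i, j))" "b' = (\<lambda>i l. B' $$ (i, l))"
    have mats: "A \<in> carrier_mat r r" "B \<in> carrier_mat r \<kappa>" "A' \<in> carrier_mat r r" "B' \<in> carrier_mat r \<kappa>"
      and rows: "\<And>i. i < r \<Longrightarrow> (\<Sum>j<r. a i j) = 1" "\<And>i. i < r \<Longrightarrow> (\<Sum>l<\<kappa>. b i l) = 1"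
        "\<And>i. i < r \<Longrightarrow> (\<Sum>j<r. a' i j) = 1" "\<And>i. i < r \<Longrightarrow> (\<Sum>l<\<kappa>. b' i l) = 1"
      using AB AB' by (auto simp: hmm_params_def stochastic_mat_def ab)
    obtain p where p: "(THE p. stationary_vec A p) = p"
        "\<And>j. j < r \<Longrightarrow> (\<Sum>i<r. p $ i * a i j) = p $ j" "(\<Sum>i<r. p $ i) = 1"
      using hmm_params_stationary[OF AB] unfolding ab by metis
    define p' where "p' = (THE p. stationary_vec A' p)"
    have "hmm_coords r \<kappa> A B \<in> carrier_vec ?N" by (simp add: hmm_coords_def)
    then have "g (hmm_coords r \<kappa> A B) \<noteq> 0" using generic by blast
    moreover have "g (hmm_coords r \<kappa> A B) = genericity r w a b"
      unfolding g_def using assms(1,2) rows w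
      by (intro genericity_cong[where \<kappa> = \<kappa> and k = k])
        (auto simp: transition_of_hmm_coords emission_of_hmm_coords ab)
    ultimately have "genericity r w a b \<noteq> 0" by simp
    then have det_b: "det (square r (\<lambda>j. backward r a b (w j))) \<noteq> 0"
      and det_f: "det (square r (\<lambda>j. forward r a b (($) p) (w j))) \<noteq> 0"
      and inj_b: "inj_on (\<lambda>i. b i 0) {..<r}"
      using det_forward_stationary_cofactors[where p = "($) p" and b = b and w = w, OF p(2,3)]
        prod_differences_nonzero_iff[where r = r and y = "\<lambda>i. b i 0"]
      by (auto simp: genericity_def)
    have law_words: "(\<Sum>z<r. forward r a b (($) p) v z) = (\<Sum>z<r. forward r a' b' (($) p') v z)"
      if "v \<in> words \<kappa> (2 * k + 1)" for v
      using word_law_of_hmm_pmf[OF AB p(1)[symmetric], of v "2 * k"]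
        word_law_of_hmm_pmf[OF AB' p'_def, of v "2 * k"] that law by (simp add: ab)
    obtain \<sigma> where "\<sigma> permutes {..<r}"
      and "\<And>i j. i < r \<Longrightarrow> j < r \<Longrightarrow> a' i j = a (\<sigma> i) (\<sigma> j)"
      and "\<And>i l. i < r \<Longrightarrow> l < \<kappa> \<Longrightarrow> b' i l = b (\<sigma> i) l"
      using hmm_uniqueness[where r = r and \<kappa> = \<kappa> and k = k and a = a and b = b and a' = a' and b' = b'
          and p = "($) p" and p' = "($) p'" and w = w, OF rows law_words w det_f det_b _ inj_b]
        assms(2) small by auto
    then show ?thesis using mats by (intro label_swap_eqI) (auto simp: ab)
  qed
  ultimately show ?thesis
    unfolding hmm_generically_identifiable_def
    by (intro exI[of _ "{x \<in> carrier_vec ?N. g x = 0}"]) blast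
qed

end
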